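(* Locally integrally equivalent subgroups need not be isomorphic: there exist a finite group $G$ and subgroups $H_1,H_2\le G$ that are locally integrally equivalent but such that $H_1$ and $H_2$ are not isomorphic as abstract groups.
   Context: For a finite group $G$, a subgroup $H\le G$ and a commutative ring $R$, $R[H\backslash G]$ denotes the permutation module: the free $R$-module with basis the set of right cosets of $H$ in $G$, with the $R$-linear extension of the right action of $G$ on cosets. Subgroups $H_1,H_2\le G$ are locally integrally equivalent if $\mathbf{Z}_p[H_1\backslash G]\simeq \mathbf{Z}_p[H_2\backslash G]$ as $\mathbf{Z}_p[G]$-modules for every prime $p$, where $\mathbf{Z}_p$ is the ring of $p$-adic integers. *)

theory Defs
  imports "HOL-Algebra.Coset" "HOL-Algebra.Module" "HOL-Computational_Algebra.Primes"
begin

section \<open>The ring of p-adic integers\<close>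

text \<open>The inverse limit of the rings Z/p^n: a p-adic integer is the sequence of its least
  non-negative residues modulo p^n.\<close>

definition padic_integers :: "nat \<Rightarrow> (nat \<Rightarrow> int) ring" where
  "padic_integers p =
    \<lparr>carrier = {x. \<forall>n. x n \<in> {0..<int p ^ n} \<and> x (Suc n) mod int p ^ n = x n},
     monoid.mult = (\<lambda>x y n. (x n * y n) mod int p ^ n),
     one = (\<lambda>n. 1 mod int p ^ n),
     zero = (\<lambda>n. 0),
     add = (\<lambda>x y n. (x n + y n) mod int p ^ n)\<rparr>"

lemma cring_padic_integers:
  assumes "0 < p"
  shows "cring (padic_integers p)"
proof (rule cringI)
  have pos: "\<And>n. int p ^ n > 0" using assms by simp
  show "abelian_group (padic_integers p)"
  proof (rule abelian_groupI)
    fix x y assume x: "x \<in> carrier (padic_integers p)" and y: "y \<in> carrier (padic_integers p)"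
    have "(x (Suc n) + y (Suc n)) mod int p ^ Suc n mod int p ^ n = (x n + y n) mod int p ^ n" for n
    proof -
      have "(x (Suc n) + y (Suc n)) mod int p ^ Suc n mod int p ^ n
          = (x (Suc n) mod int p ^ n + y (Suc n) mod int p ^ n) mod int p ^ n"
        by (simp add: mod_mod_cancel mod_add_eq)
      then show ?thesis using x y by (simp add: padic_integers_def)
    qed
    then show "x \<oplus>\<^bsub>padic_integers p\<^esub> y \<in> carrier (padic_integers p)"
      using pos by (simp add: padic_integers_def)
  next
    fix x assume x: "x \<in> carrier (padic_integers p)"
    let ?y = "\<lambda>n. (- x n) mod int p ^ n"
    have "(- x (Suc n)) mod int p ^ Suc n mod int p ^ n = (- x n) mod int p ^ n" for n
    proof -
      have "(- x (Suc n)) mod int p ^ Suc n mod int p ^ n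
          = (- (x (Suc n) mod int p ^ n)) mod int p ^ n"
        by (simp add: mod_mod_cancel mod_minus_eq)
      then show ?thesis using x by (simp add: padic_integers_def)
    qed
    then have "?y \<in> carrier (padic_integers p)"
      using pos by (simp add: padic_integers_def)
    moreover have "?y \<oplus>\<^bsub>padic_integers p\<^esub> x = \<zero>\<^bsub>padic_integers p\<^esub>"
      by (simp add: padic_integers_def mod_simps)
    ultimately show "\<exists>y\<in>carrier (padic_integers p). y \<oplus>\<^bsub>padic_integers p\<^esub> x = \<zero>\<^bsub>padic_integers p\<^esub>"
      by blast
  qed (use pos in \<open>auto simp: padic_integers_def mod_simps fun_eq_iff ac_simps\<close>)
  show "comm_monoid (padic_integers p)"
  proof (rule comm_monoidI)
    fix x y assume x: "x \<in> carrier (padic_integers p)" and y: "y \<in> carrier (padic_integers p)"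
    have "(x (Suc n) * y (Suc n)) mod int p ^ Suc n mod int p ^ n = (x n * y n) mod int p ^ n" for n
    proof -
      have "(x (Suc n) * y (Suc n)) mod int p ^ Suc n mod int p ^ n
          = ((x (Suc n) mod int p ^ n) * (y (Suc n) mod int p ^ n)) mod int p ^ n"
        by (simp add: mod_mod_cancel mod_mult_eq)
      then show ?thesis using x y by (simp add: padic_integers_def)
    qed
    then show "x \<otimes>\<^bsub>padic_integers p\<^esub> y \<in> carrier (padic_integers p)"
      using pos by (simp add: padic_integers_def)
  next
    show "\<one>\<^bsub>padic_integers p\<^esub> \<in> carrier (padic_integers p)"
      using pos by (simp add: padic_integers_def mod_mod_cancel)
  qed (use pos in \<open>auto simp: padic_integers_def mod_simps fun_eq_iff ac_simps\<close>)
qed (auto simp: padic_integers_def mod_simps fun_eq_iff distrib_right)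

section \<open>Modules over group rings\<close>

text \<open>A right module over R[G] is an R-module with an R-linear right action of G; a homomorphism
  of R[G]-modules is an R-linear map commuting with G.\<close>

record ('r, 'g, 'm) gmodule = "('r, 'm) module" +
  act :: "'m \<Rightarrow> 'g \<Rightarrow> 'm"

locale gmodule = module R M + G?: group G
  for R (structure) and G (structure) and M (structure) +
  assumes act_closed:
      "\<lbrakk>x \<in> carrier M; g \<in> carrier G\<rbrakk> \<Longrightarrow> act M x g \<in> carrier M"
    and act_add:
      "\<lbrakk>x \<in> carrier M; y \<in> carrier M; g \<in> carrier G\<rbrakk> \<Longrightarrow>
        act M (x \<oplus>\<^bsub>M\<^esub> y) g = act M x g \<oplus>\<^bsub>M\<^esub> act M y g"
    and act_smult:
      "\<lbrakk>r \<in> carrier R; x \<in> carrier M; g \<in> carrier G\<rbrakk> \<Longrightarrow>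
        act M (r \<odot>\<^bsub>M\<^esub> x) g = r \<odot>\<^bsub>M\<^esub> act M x g"
    and act_one:
      "x \<in> carrier M \<Longrightarrow> act M x \<one>\<^bsub>G\<^esub> = x"
    and act_mult:
      "\<lbrakk>x \<in> carrier M; g \<in> carrier G; h \<in> carrier G\<rbrakk> \<Longrightarrow>
        act M x (g \<otimes>\<^bsub>G\<^esub> h) = act M (act M x g) h"

definition gmodule_iso ::
    "('r, 'a) ring_scheme \<Rightarrow> ('g, 'b) monoid_scheme \<Rightarrow> ('r, 'g, 'm, 'c) gmodule_scheme
      \<Rightarrow> ('r, 'g, 'n, 'd) gmodule_scheme \<Rightarrow> ('m \<Rightarrow> 'n) set" where
  "gmodule_iso R G M N = {\<phi>. bij_betw \<phi> (carrier M) (carrier N)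
    \<and> (\<forall>x\<in>carrier M. \<forall>y\<in>carrier M. \<phi> (x \<oplus>\<^bsub>M\<^esub> y) = \<phi> x \<oplus>\<^bsub>N\<^esub> \<phi> y)
    \<and> (\<forall>r\<in>carrier R. \<forall>x\<in>carrier M. \<phi> (r \<odot>\<^bsub>M\<^esub> x) = r \<odot>\<^bsub>N\<^esub> \<phi> x)
    \<and> (\<forall>x\<in>carrier M. \<forall>g\<in>carrier G. \<phi> (act M x g) = act N (\<phi> x) g)}"

section \<open>Permutation modules\<close>

text \<open>The module R[H\G] for a finite group G. An element is given by its coordinates with respect
  to the basis of right cosets. The R-linear extension of the action on cosets sends the sum of
  f(C) C over all C to the sum of f(C) Cg, whose coordinate at D is f(D g^-1). The two
  multiplicative fields, which the record of modules inherits from that of rings, have no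
  meaning for a module.\<close>

definition perm_module ::
    "('r, 'a) ring_scheme \<Rightarrow> ('g, 'b) monoid_scheme \<Rightarrow> 'g set \<Rightarrow> ('r, 'g, 'g set \<Rightarrow> 'r) gmodule" where
  "perm_module R G H =
    \<lparr>carrier = (rcosets\<^bsub>G\<^esub> H) \<rightarrow>\<^sub>E carrier R,
     monoid.mult = undefined,
     one = undefined,
     zero = (\<lambda>C\<in>rcosets\<^bsub>G\<^esub> H. \<zero>\<^bsub>R\<^esub>),
     add = (\<lambda>f f'. \<lambda>C\<in>rcosets\<^bsub>G\<^esub> H. f C \<oplus>\<^bsub>R\<^esub> f' C),
     smult = (\<lambda>r f. \<lambda>C\<in>rcosets\<^bsub>G\<^esub> H. r \<otimes>\<^bsub>R\<^esub> f C),
     act = (\<lambda>f g. \<lambda>C\<in>rcosets\<^bsub>G\<^esub> H. f (C #>\<^bsub>G\<^esub> inv\<^bsub>G\<^esub> g))\<rparr>"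

definition perm_basis ::
    "('r, 'a) ring_scheme \<Rightarrow> ('g, 'b) monoid_scheme \<Rightarrow> 'g set \<Rightarrow> 'g set \<Rightarrow> 'g set \<Rightarrow> 'r" where
  "perm_basis R G H C = (\<lambda>D\<in>rcosets\<^bsub>G\<^esub> H. if D = C then \<one>\<^bsub>R\<^esub> else \<zero>\<^bsub>R\<^esub>)"

lemma (in group) rcosets_r_coset_closed:
  assumes "subgroup H G" "C \<in> rcosets H" "g \<in> carrier G"
  shows "C #> g \<in> rcosets H"
proof -
  obtain a where "a \<in> carrier G" "C = H #> a"
    using assms(2) by (auto simp: RCOSETS_def)
  then show ?thesis
    using assms by (simp add: coset_mult_assoc rcosetsI subgroup.subset)
qed

lemma gmodule_perm_module:
  assumes R: "cring R" and G: "group G" and H: "subgroup H G"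
  shows "gmodule R G (perm_module R G H)"
proof -
  interpret R: cring R by fact
  interpret G: group G by fact
  have sub: "C \<subseteq> carrier G" if "C \<in> rcosets\<^bsub>G\<^esub> H" for C
    using that H G.rcosets_subset_PowG by blast
  note cl = G.rcosets_r_coset_closed[OF H]
  have "abelian_group (perm_module R G H)"
  proof (rule abelian_groupI)
    fix x assume x: "x \<in> carrier (perm_module R G H)"
    show "\<exists>y\<in>carrier (perm_module R G H). y \<oplus>\<^bsub>perm_module R G H\<^esub> x = \<zero>\<^bsub>perm_module R G H\<^esub>"
      by (rule bexI[of _ "\<lambda>C\<in>rcosets\<^bsub>G\<^esub> H. \<ominus>\<^bsub>R\<^esub> x C"])
        (use x in \<open>auto simp: perm_module_def fun_eq_iff PiE_iff R.l_neg\<close>)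
  qed (auto simp: perm_module_def fun_eq_iff PiE_iff extensional_def R.a_ac)
  then have "module R (perm_module R G H)"
    by (rule moduleI[OF R])
      (auto simp: perm_module_def fun_eq_iff PiE_iff extensional_def R.l_distr R.r_distr R.m_assoc)
  then show ?thesis
    by (intro gmodule.intro G gmodule_axioms.intro)
      (auto simp: perm_module_def fun_eq_iff PiE_iff extensional_def cl sub
        G.coset_mult_assoc G.inv_mult_group)
qed

lemma act_perm_basis:
  assumes G: "group G" and H: "subgroup H G" and C: "C \<in> rcosets\<^bsub>G\<^esub> H" and g: "g \<in> carrier G"
  shows "act (perm_module R G H) (perm_basis R G H C) g = perm_basis R G H (C #>\<^bsub>G\<^esub> g)"
proof -
  interpret G: group G by fact
  have sub: "D \<subseteq> carrier G" if "D \<in> rcosets\<^bsub>G\<^esub> H" for D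
    using that H G.rcosets_subset_PowG by blast
  have "D #>\<^bsub>G\<^esub> inv\<^bsub>G\<^esub> g = C \<longleftrightarrow> D = C #>\<^bsub>G\<^esub> g" if "D \<in> rcosets\<^bsub>G\<^esub> H" for D
    using sub[OF that] sub[OF C] g by (auto simp: G.coset_mult_assoc)
  then show ?thesis
    using G.rcosets_r_coset_closed[OF H] g
    by (auto simp: perm_module_def perm_basis_def fun_eq_iff)
qed

section \<open>Local integral equivalence\<close>

definition locally_integrally_equivalent ::
    "('g, 'b) monoid_scheme \<Rightarrow> 'g set \<Rightarrow> 'g set \<Rightarrow> bool" where
  "locally_integrally_equivalent G H\<^sub>1 H\<^sub>2 \<longleftrightarrow>
    (\<forall>p. Factorial_Ring.prime p \<longrightarrow>
      gmodule_iso (padic_integers p) G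
        (perm_module (padic_integers p) G H\<^sub>1) (perm_module (padic_integers p) G H\<^sub>2) \<noteq> {})"

end

theory Submission
  imports Defs "HOL-Algebra.Sym_Groups" "HOL-Algebra.Weak_Morphisms" "HOL-Number_Theory.Cong"
begin

text \<open>The permutation module of \<open>H\<close> is the module of left \<open>H\<close>-invariant functions on \<open>G\<close>, on which
  \<open>G\<close> acts by right translation. Integral combinations of left translations commute with this
  action, so it suffices to find two of them, exchanging the invariants of \<open>H\<^sub>1\<close> and \<open>H\<^sub>2\<close>,
  whose composites are multiplication by an integer \<open>d\<close> prime to \<open>p\<close>. We do this with \<open>d = 9\<close>
  and \<open>d = 16\<close>.

  Both subgroups are semidirect products of the group of order 3 generated by \<open>\<rho>\<close> with
  \<open>P = \<langle>\<alpha>, \<beta>, Z\<rangle>\<close>, where \<open>Z\<close> is elementary abelian and central in \<open>P\<close>, \<open>\<alpha>\<^sup>2 = [\<alpha>, \<beta>]\<close> and \<open>\<beta>\<^sup>2\<close>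
  lie in \<open>Z\<close>, and \<open>\<beta>\<^sup>2\<close> is not a power of \<open>\<alpha>\<^sup>2\<close>. In \<open>H\<^sub>1\<close> the generator \<open>\<beta>\<close> inverts \<open>\<rho>\<close> and \<open>\<alpha>\<close>
  centralises it; in \<open>H\<^sub>2\<close> the roles are exchanged. This asymmetry makes them non-isomorphic. The
  ambient group contains \<open>\<theta>\<close>, which conjugates \<open>\<alpha>\<close> to \<open>\<beta>\<close> and normalises \<open>Z\<close>, and \<open>\<nu>\<close>, which exchanges
  the two involutions \<open>\<sigma>\<close>, \<open>\<zeta>\<close> attached to \<open>\<beta>\<close> and \<open>\<alpha>\<close>. Thus \<open>\<theta>\<close> fuses the centralisers of \<open>\<rho>\<close> in
  \<open>H\<^sub>1\<close> and \<open>H\<^sub>2\<close>, and \<open>\<nu>\<close> fuses their Sylow 2-subgroups.\<close>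

section \<open>Invariant functions and left translations\<close>

text \<open>Vanishing off the carrier makes the invariance equations hold for all arguments when the
  multiplication is a total cancellative operation, such as composition of functions.\<close>

definition left_invariant :: "('g, 'b) monoid_scheme \<Rightarrow> 'g set \<Rightarrow> ('g \<Rightarrow> int) \<Rightarrow> bool" where
  "left_invariant G H F \<longleftrightarrow>
    (\<forall>h\<in>H. \<forall>x\<in>carrier G. F (h \<otimes>\<^bsub>G\<^esub> x) = F x) \<and> (\<forall>x. x \<notin> carrier G \<longrightarrow> F x = 0)"

text \<open>The list stands for an element of the group ring; in the word sum the words act in reversed
  order, as \<open>x \<mapsto> F (w x)\<close> is a right action of \<open>w\<close>.\<close>

definition word_sum :: "('g, 'b) monoid_scheme \<Rightarrow> (int \<times> 'g) list \<Rightarrow> ('g \<Rightarrow> int) \<Rightarrow> 'g \<Rightarrow> int" where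
  "word_sum G u F x = (if x \<in> carrier G then \<Sum>q\<leftarrow>u. fst q * F (snd q \<otimes>\<^bsub>G\<^esub> x) else 0)"

definition intertwines ::
    "('g, 'b) monoid_scheme \<Rightarrow> 'g set \<Rightarrow> 'g set \<Rightarrow> (int \<times> 'g) list \<Rightarrow> bool" where
  "intertwines G H\<^sub>1 H\<^sub>2 u \<longleftrightarrow> snd ` set u \<subseteq> carrier G
    \<and> (\<forall>F. left_invariant G H\<^sub>1 F \<longrightarrow> left_invariant G H\<^sub>2 (word_sum G u F))"

text \<open>A pair of integral maps inverse to each other up to the scalar \<open>d\<close> becomes
  an isomorphism wherever \<open>d\<close> is a unit. The words do not depend on a prime, so one
  finite computation serves all primes not dividing \<open>d\<close>.\<close>

definition isogenous :: "('g, 'b) monoid_scheme \<Rightarrow> 'g set \<Rightarrow> 'g set \<Rightarrow> int \<Rightarrow> bool" where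
  "isogenous G H\<^sub>1 H\<^sub>2 d \<longleftrightarrow> (\<exists>u v. intertwines G H\<^sub>1 H\<^sub>2 u \<and> intertwines G H\<^sub>2 H\<^sub>1 v
    \<and> (\<forall>F. left_invariant G H\<^sub>1 F \<longrightarrow> (\<forall>x\<in>carrier G. word_sum G v (word_sum G u F) x = d * F x))
    \<and> (\<forall>F. left_invariant G H\<^sub>2 F \<longrightarrow> (\<forall>x\<in>carrier G. word_sum G u (word_sum G v F) x = d * F x)))"

lemma left_invariant_eq:
  "\<lbrakk>left_invariant G H F; h \<in> H; x \<in> carrier G\<rbrakk> \<Longrightarrow> F (h \<otimes>\<^bsub>G\<^esub> x) = F x"
  by (simp add: left_invariant_def)

lemma (in group) left_invariant_generate:
  assumes S: "S \<subseteq> carrier G"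
    and inv: "\<And>s x. \<lbrakk>s \<in> S; x \<in> carrier G\<rbrakk> \<Longrightarrow> F (s \<otimes> x) = F x"
    and out: "\<And>x. x \<notin> carrier G \<Longrightarrow> F x = 0"
  shows "left_invariant G (generate G S) F"
proof -
  have "F (h \<otimes> x) = F x" if "h \<in> generate G S" "x \<in> carrier G" for h x
    using that
  proof (induction arbitrary: x rule: generate.induct)
    case (inv h)
    with S have "h \<in> carrier G" by blast
    with inv assms(2)[of h "inv h \<otimes> x"] show ?case by (simp add: m_assoc[symmetric])
  next
    case (eng h1 h2)
    then show ?case using generate_in_carrier[OF S] by (simp add: m_assoc)
  qed (use S inv in auto)
  with out show ?thesis by (simp add: left_invariant_def)
qed

text \<open>The module operations over the p-adic integers reduce residues modulo
  \<open>p ^ n\<close>; this allows word sums to be computed with unreduced integers.\<close>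

lemma word_sum_cong_mod:
  assumes "\<And>x. F x mod q = F' x mod q"
  shows "word_sum G u F x mod q = word_sum G u F' x mod q"
proof -
  have "(\<Sum>a\<leftarrow>u. fst a * F (snd a \<otimes>\<^bsub>G\<^esub> x)) mod q = (\<Sum>a\<leftarrow>u. fst a * F' (snd a \<otimes>\<^bsub>G\<^esub> x)) mod q"
  proof (induction u)
    case (Cons a u)
    show ?case
      using mod_mult_cong[OF refl assms] Cons.IH by (auto intro: mod_add_cong)
  qed simp
  then show ?thesis by (simp add: word_sum_def)
qed

lemma word_sum_cong:
  assumes "group G" "snd ` set u \<subseteq> carrier G" "\<And>x. x \<in> carrier G \<Longrightarrow> F x = F' x"
  shows "word_sum G u F x = word_sum G u F' x"
proof -
  interpret group G by fact
  have "map (\<lambda>a. fst a * F (snd a \<otimes>\<^bsub>G\<^esub> x)) u = map (\<lambda>a. fst a * F' (snd a \<otimes>\<^bsub>G\<^esub> x)) u"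
    if "x \<in> carrier G"
    using that assms(2,3) by (auto simp: subset_iff image_iff)
  then show ?thesis by (simp add: word_sum_def del: map_eq_conv)
qed

lemma word_sum_add:
  "word_sum G u (\<lambda>x. F x + F' x) x = word_sum G u F x + word_sum G u F' x"
  by (simp add: word_sum_def distrib_left sum_list_addf)

lemma word_sum_mult:
  "word_sum G u (\<lambda>x. r * F x) x = r * word_sum G u F x"
  by (simp add: word_sum_def sum_list_const_mult mult.left_commute[of _ r])

text \<open>Left and right translations commute by associativity. This is the source of the
  equivariance of \<open>coset_map\<close>.\<close>

lemma word_sum_translate:
  assumes "group G" "snd ` set u \<subseteq> carrier G" "x \<in> carrier G" "g \<in> carrier G"
  shows "word_sum G u (\<lambda>x. F (x \<otimes>\<^bsub>G\<^esub> g)) x = word_sum G u F (x \<otimes>\<^bsub>G\<^esub> g)"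
proof -
  interpret group G by fact
  have "map (\<lambda>a. fst a * F (snd a \<otimes>\<^bsub>G\<^esub> x \<otimes>\<^bsub>G\<^esub> g)) u
      = map (\<lambda>a. fst a * F (snd a \<otimes>\<^bsub>G\<^esub> (x \<otimes>\<^bsub>G\<^esub> g))) u"
    using assms by (auto simp: m_assoc subset_iff image_iff)
  then show ?thesis using assms by (simp add: word_sum_def del: map_eq_conv)
qed

section \<open>From translations to isomorphisms over the p-adic integers\<close>

text \<open>The reduction modulo \<open>p ^ n\<close> of a module element, spread out to a function on the group.\<close>

definition level :: "('g, 'b) monoid_scheme \<Rightarrow> 'g set \<Rightarrow> nat \<Rightarrow> ('g set \<Rightarrow> nat \<Rightarrow> int) \<Rightarrow> 'g \<Rightarrow> int" where
  "level G H n f x = (if x \<in> carrier G then f (H #>\<^bsub>G\<^esub> x) n else 0)"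

text \<open>For an intertwining \<open>u\<close> the word sum is constant on right cosets of
  \<open>H\<^sub>2\<close>, so the representative picked by \<open>SOME\<close> is
  immaterial.\<close>

definition coset_map ::
    "('g, 'b) monoid_scheme \<Rightarrow> 'g set \<Rightarrow> 'g set \<Rightarrow> nat \<Rightarrow> (int \<times> 'g) list
      \<Rightarrow> ('g set \<Rightarrow> nat \<Rightarrow> int) \<Rightarrow> 'g set \<Rightarrow> nat \<Rightarrow> int" where
  "coset_map G H\<^sub>1 H\<^sub>2 p u f =
    (\<lambda>C\<in>rcosets\<^bsub>G\<^esub> H\<^sub>2. \<lambda>n. word_sum G u (level G H\<^sub>1 n f) (SOME x. x \<in> C) mod int p ^ n)"

abbreviation padic_perm_module where
  "padic_perm_module p G H \<equiv> perm_module (padic_integers p) G H"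

lemma left_invariant_level:
  assumes "group G" "subgroup H G"
  shows "left_invariant G H (level G H n f)"
proof -
  interpret group G by fact
  interpret subgroup H G by fact
  have "H #>\<^bsub>G\<^esub> (h \<otimes>\<^bsub>G\<^esub> x) = H #>\<^bsub>G\<^esub> x" if "h \<in> H" "x \<in> carrier G" for h x
    using that coset_mult_assoc[OF subset, of h x] rcos_const[OF is_group] by simp
  then show ?thesis by (simp add: left_invariant_def level_def)
qed

text \<open>Coordinates are least residues, so congruence at every level forces equality. Identities
  between module elements thus become congruences between integer-valued functions on the
  group.\<close>

lemma level_eqI:
  assumes "0 < p" "f \<in> carrier (padic_perm_module p G H)" "f' \<in> carrier (padic_perm_module p G H)"
    and eq: "\<And>n x. x \<in> carrier G \<Longrightarrow> level G H n f x mod int p ^ n = level G H n f' x mod int p ^ n"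
  shows "f = f'"
proof (rule ext)
  fix C
  show "f C = f' C"
  proof (cases "C \<in> rcosets\<^bsub>G\<^esub> H")
    case True
    then obtain x where x: "x \<in> carrier G" "C = H #>\<^bsub>G\<^esub> x" by (auto simp: RCOSETS_def)
    have range: "f C n \<in> {0..<int p ^ n}" "f' C n \<in> {0..<int p ^ n}" for n
      using assms(2,3) True by (auto simp: perm_module_def padic_integers_def PiE_iff)
    show ?thesis
    proof
      fix n
      show "f C n = f' C n" using eq[OF x(1), of n] range[of n] x by (simp add: level_def)
    qed
  next
    case False
    then show ?thesis using assms(2,3) by (auto simp: perm_module_def PiE_iff extensional_def)
  qed
qed

section \<open>Linearity, equivariance and composition of the maps on coset functions\<close>

context
  fixes G :: "('g, 'b) monoid_scheme" (structure) and p :: nat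
  assumes G: "group G" and p: "0 < p"
begin

interpretation group G by (fact G)

lemma level_add:
  "x \<in> carrier G \<Longrightarrow> level G H n (f \<oplus>\<^bsub>padic_perm_module p G H\<^esub> f') x
    = (level G H n f x + level G H n f' x) mod int p ^ n"
  by (auto simp: level_def perm_module_def padic_integers_def RCOSETS_def)

lemma level_smult:
  "x \<in> carrier G \<Longrightarrow> level G H n (r \<odot>\<^bsub>padic_perm_module p G H\<^esub> f) x
    = (r n * level G H n f x) mod int p ^ n"
  by (auto simp: level_def perm_module_def padic_integers_def RCOSETS_def)

lemma level_act:
  assumes "subgroup H G" "x \<in> carrier G" "g \<in> carrier G"
  shows "level G H n (act (padic_perm_module p G H) f g) x = level G H n f (x \<otimes> inv g)"
proof -
  have "H #> x \<in> rcosets H" using assms by (auto simp: RCOSETS_def)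
  with assms show ?thesis
    by (simp add: level_def perm_module_def coset_mult_assoc subgroup.subset)
qed

lemma level_mod:
  assumes "f \<in> carrier (padic_perm_module p G H)"
  shows "level G H n f x mod int p ^ n = level G H n f x"
    and "level G H (Suc n) f x mod int p ^ n = level G H n f x"
proof -
  have "f (H #> x) n mod int p ^ n = f (H #> x) n \<and> f (H #> x) (Suc n) mod int p ^ n = f (H #> x) n"
    if "x \<in> carrier G"
  proof -
    have "H #> x \<in> rcosets H" using that by (auto simp: RCOSETS_def)
    then have "f (H #> x) \<in> carrier (padic_integers p)"
      using assms by (auto simp: perm_module_def PiE_iff)
    then have "f (H #> x) n \<in> {0..<int p ^ n}" "f (H #> x) (Suc n) mod int p ^ n = f (H #> x) n"
      by (auto simp: padic_integers_def)
    then show ?thesis by simp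
  qed
  then show "level G H n f x mod int p ^ n = level G H n f x"
    "level G H (Suc n) f x mod int p ^ n = level G H n f x"
    by (auto simp: level_def)
qed

context
  fixes H\<^sub>1 H\<^sub>2 :: "'g set" and u :: "(int \<times> 'g) list"
  assumes H\<^sub>1: "subgroup H\<^sub>1 G" and H\<^sub>2: "subgroup H\<^sub>2 G" and u: "intertwines G H\<^sub>1 H\<^sub>2 u"
begin

lemma level_coset_map:
  assumes x: "x \<in> carrier G"
  shows "level G H\<^sub>2 n (coset_map G H\<^sub>1 H\<^sub>2 p u f) x = word_sum G u (level G H\<^sub>1 n f) x mod int p ^ n"
proof -
  have "x \<in> H\<^sub>2 #> x" using x H\<^sub>2 by (rule rcos_self)
  then have "(SOME y. y \<in> H\<^sub>2 #> x) \<in> H\<^sub>2 #> x" by (rule someI)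
  then obtain h where h: "h \<in> H\<^sub>2" "(SOME y. y \<in> H\<^sub>2 #> x) = h \<otimes> x" by (auto simp: r_coset_def)
  have "left_invariant G H\<^sub>2 (word_sum G u (level G H\<^sub>1 n f))"
    using u left_invariant_level[OF G H\<^sub>1] by (simp add: intertwines_def)
  then have "word_sum G u (level G H\<^sub>1 n f) (h \<otimes> x) = word_sum G u (level G H\<^sub>1 n f) x"
    using h(1) x by (rule left_invariant_eq)
  moreover have "H\<^sub>2 #> x \<in> rcosets H\<^sub>2" using x by (auto simp: RCOSETS_def)
  ultimately show ?thesis using x h(2) by (simp add: level_def coset_map_def)
qed

lemma coset_map_closed:
  assumes f: "f \<in> carrier (padic_perm_module p G H\<^sub>1)"
  shows "coset_map G H\<^sub>1 H\<^sub>2 p u f \<in> carrier (padic_perm_module p G H\<^sub>2)"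
proof -
  \<comment> \<open>This is the compatibility condition of the inverse limit.\<close>
  have "word_sum G u (level G H\<^sub>1 (Suc n) f) x mod int p ^ n
      = word_sum G u (level G H\<^sub>1 n f) x mod int p ^ n" for n x
    using level_mod[OF f] by (intro word_sum_cong_mod) simp
  then show ?thesis
    using p by (auto simp: perm_module_def padic_integers_def coset_map_def mod_mod_cancel)
qed

lemma coset_map_add:
  assumes f: "f \<in> carrier (padic_perm_module p G H\<^sub>1)" "f' \<in> carrier (padic_perm_module p G H\<^sub>1)"
  shows "coset_map G H\<^sub>1 H\<^sub>2 p u (f \<oplus>\<^bsub>padic_perm_module p G H\<^sub>1\<^esub> f')
    = coset_map G H\<^sub>1 H\<^sub>2 p u f \<oplus>\<^bsub>padic_perm_module p G H\<^sub>2\<^esub> coset_map G H\<^sub>1 H\<^sub>2 p u f'"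
proof (rule level_eqI[OF p])
  interpret M\<^sub>1: gmodule "padic_integers p" G "padic_perm_module p G H\<^sub>1"
    by (rule gmodule_perm_module[OF cring_padic_integers[OF p] G H\<^sub>1])
  interpret M\<^sub>2: gmodule "padic_integers p" G "padic_perm_module p G H\<^sub>2"
    by (rule gmodule_perm_module[OF cring_padic_integers[OF p] G H\<^sub>2])
  show "coset_map G H\<^sub>1 H\<^sub>2 p u (f \<oplus>\<^bsub>padic_perm_module p G H\<^sub>1\<^esub> f') \<in> carrier (padic_perm_module p G H\<^sub>2)"
    using f by (intro coset_map_closed M\<^sub>1.a_closed)
  show "coset_map G H\<^sub>1 H\<^sub>2 p u f \<oplus>\<^bsub>padic_perm_module p G H\<^sub>2\<^esub> coset_map G H\<^sub>1 H\<^sub>2 p u f'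
      \<in> carrier (padic_perm_module p G H\<^sub>2)"
    using f by (intro coset_map_closed M\<^sub>2.a_closed)
  fix n x assume x: "x \<in> carrier G"
  have "word_sum G u (level G H\<^sub>1 n (f \<oplus>\<^bsub>padic_perm_module p G H\<^sub>1\<^esub> f')) x mod int p ^ n
      = word_sum G u (\<lambda>x. level G H\<^sub>1 n f x + level G H\<^sub>1 n f' x) x mod int p ^ n"
    using level_add by (intro word_sum_cong_mod) (auto simp: level_def)
  then show "level G H\<^sub>2 n (coset_map G H\<^sub>1 H\<^sub>2 p u (f \<oplus>\<^bsub>padic_perm_module p G H\<^sub>1\<^esub> f')) x mod int p ^ n
    = level G H\<^sub>2 n (coset_map G H\<^sub>1 H\<^sub>2 p u f \<oplus>\<^bsub>padic_perm_module p G H\<^sub>2\<^esub> coset_map G H\<^sub>1 H\<^sub>2 p u f') x mod int p ^ n"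
    using x by (simp add: level_coset_map level_add word_sum_add mod_add_eq)
qed

lemma coset_map_smult:
  assumes f: "f \<in> carrier (padic_perm_module p G H\<^sub>1)" and r: "r \<in> carrier (padic_integers p)"
  shows "coset_map G H\<^sub>1 H\<^sub>2 p u (r \<odot>\<^bsub>padic_perm_module p G H\<^sub>1\<^esub> f)
    = r \<odot>\<^bsub>padic_perm_module p G H\<^sub>2\<^esub> coset_map G H\<^sub>1 H\<^sub>2 p u f"
proof (rule level_eqI[OF p])
  interpret M\<^sub>1: gmodule "padic_integers p" G "padic_perm_module p G H\<^sub>1"
    by (rule gmodule_perm_module[OF cring_padic_integers[OF p] G H\<^sub>1])
  interpret M\<^sub>2: gmodule "padic_integers p" G "padic_perm_module p G H\<^sub>2"
    by (rule gmodule_perm_module[OF cring_padic_integers[OF p] G H\<^sub>2])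
  show "coset_map G H\<^sub>1 H\<^sub>2 p u (r \<odot>\<^bsub>padic_perm_module p G H\<^sub>1\<^esub> f) \<in> carrier (padic_perm_module p G H\<^sub>2)"
    using f r by (intro coset_map_closed M\<^sub>1.smult_closed)
  show "r \<odot>\<^bsub>padic_perm_module p G H\<^sub>2\<^esub> coset_map G H\<^sub>1 H\<^sub>2 p u f \<in> carrier (padic_perm_module p G H\<^sub>2)"
    using f r by (intro coset_map_closed M\<^sub>2.smult_closed)
  fix n x assume x: "x \<in> carrier G"
  have "word_sum G u (level G H\<^sub>1 n (r \<odot>\<^bsub>padic_perm_module p G H\<^sub>1\<^esub> f)) x mod int p ^ n
      = word_sum G u (\<lambda>x. r n * level G H\<^sub>1 n f x) x mod int p ^ n"
    using level_smult by (intro word_sum_cong_mod) (auto simp: level_def)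
  then show "level G H\<^sub>2 n (coset_map G H\<^sub>1 H\<^sub>2 p u (r \<odot>\<^bsub>padic_perm_module p G H\<^sub>1\<^esub> f)) x mod int p ^ n
    = level G H\<^sub>2 n (r \<odot>\<^bsub>padic_perm_module p G H\<^sub>2\<^esub> coset_map G H\<^sub>1 H\<^sub>2 p u f) x mod int p ^ n"
    using x by (simp add: level_coset_map level_smult word_sum_mult mod_mult_right_eq)
qed

lemma coset_map_act:
  assumes f: "f \<in> carrier (padic_perm_module p G H\<^sub>1)" and g: "g \<in> carrier G"
  shows "coset_map G H\<^sub>1 H\<^sub>2 p u (act (padic_perm_module p G H\<^sub>1) f g)
    = act (padic_perm_module p G H\<^sub>2) (coset_map G H\<^sub>1 H\<^sub>2 p u f) g"
proof (rule level_eqI[OF p])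
  interpret M\<^sub>1: gmodule "padic_integers p" G "padic_perm_module p G H\<^sub>1"
    by (rule gmodule_perm_module[OF cring_padic_integers[OF p] G H\<^sub>1])
  interpret M\<^sub>2: gmodule "padic_integers p" G "padic_perm_module p G H\<^sub>2"
    by (rule gmodule_perm_module[OF cring_padic_integers[OF p] G H\<^sub>2])
  show "coset_map G H\<^sub>1 H\<^sub>2 p u (act (padic_perm_module p G H\<^sub>1) f g) \<in> carrier (padic_perm_module p G H\<^sub>2)"
    using f g by (intro coset_map_closed M\<^sub>1.act_closed)
  show "act (padic_perm_module p G H\<^sub>2) (coset_map G H\<^sub>1 H\<^sub>2 p u f) g \<in> carrier (padic_perm_module p G H\<^sub>2)"
    using f g by (intro coset_map_closed M\<^sub>2.act_closed)
  fix n x assume x: "x \<in> carrier G"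
  have uc: "snd ` set u \<subseteq> carrier G" using u by (simp add: intertwines_def)
  have "word_sum G u (level G H\<^sub>1 n (act (padic_perm_module p G H\<^sub>1) f g)) x
      = word_sum G u (\<lambda>x. level G H\<^sub>1 n f (x \<otimes> inv g)) x"
    using level_act[OF H\<^sub>1 _ g] by (intro word_sum_cong[OF G uc])
  also have "\<dots> = word_sum G u (level G H\<^sub>1 n f) (x \<otimes> inv g)"
    using x g by (intro word_sum_translate[OF G uc]) auto
  finally show "level G H\<^sub>2 n (coset_map G H\<^sub>1 H\<^sub>2 p u (act (padic_perm_module p G H\<^sub>1) f g)) x mod int p ^ n
    = level G H\<^sub>2 n (act (padic_perm_module p G H\<^sub>2) (coset_map G H\<^sub>1 H\<^sub>2 p u f) g) x mod int p ^ n"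
    using x g by (simp add: level_coset_map level_act[OF H\<^sub>2])
qed

end

text \<open>Each level is itself an invariant integer-valued function, so \<open>d\<close> may be
  read off from the integral identity; the intermediate reduction modulo \<open>p ^ n\<close> is
  harmless because word sums respect congruences.\<close>

lemma level_coset_map_coset_map:
  assumes H: "subgroup H\<^sub>1 G" "subgroup H\<^sub>2 G"
    and uv: "intertwines G H\<^sub>1 H\<^sub>2 u" "intertwines G H\<^sub>2 H\<^sub>1 v"
    and d: "\<And>F y. \<lbrakk>left_invariant G H\<^sub>1 F; y \<in> carrier G\<rbrakk> \<Longrightarrow> word_sum G v (word_sum G u F) y = d * F y"
    and x: "x \<in> carrier G"
  shows "level G H\<^sub>1 n (coset_map G H\<^sub>2 H\<^sub>1 p v (coset_map G H\<^sub>1 H\<^sub>2 p u f)) x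
    = d * level G H\<^sub>1 n f x mod int p ^ n"
proof -
  have "level G H\<^sub>2 n (coset_map G H\<^sub>1 H\<^sub>2 p u f) y mod int p ^ n
      = word_sum G u (level G H\<^sub>1 n f) y mod int p ^ n" for y
    using level_coset_map[OF H uv(1), of y]
    by (cases "y \<in> carrier G") (auto simp: level_def word_sum_def)
  then have "level G H\<^sub>1 n (coset_map G H\<^sub>2 H\<^sub>1 p v (coset_map G H\<^sub>1 H\<^sub>2 p u f)) x
      = word_sum G v (word_sum G u (level G H\<^sub>1 n f)) x mod int p ^ n"
    using level_coset_map[OF H(2,1) uv(2) x] by (simp cong: word_sum_cong_mod)
  with d[OF left_invariant_level[OF G H(1)] x] show ?thesis by simp
qed

end

text \<open>Inverses modulo the powers of \<open>p\<close> are chosen independently of each other;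
  cancelling \<open>d\<close> shows that they are compatible.\<close>

lemma padic_integers_inverse:
  fixes d :: int
  assumes "coprime d (int p)" "0 < p"
  obtains e where "e \<in> carrier (padic_integers p)" "\<And>n. d * e n mod int p ^ n = 1 mod int p ^ n"
proof -
  have "\<exists>e. \<forall>n. [d * e n = 1] (mod int p ^ n)"
    using assms by (intro choice allI cong_solve_coprime_int) simp
  then obtain e where e: "\<And>n. [d * e n = 1] (mod int p ^ n)" by blast
  have "[e (Suc n) = e n] (mod int p ^ n)" for n
  proof -
    have "[d * e (Suc n) = d * e n] (mod int p ^ n)"
      using cong_dvd_modulus[OF e[of "Suc n"], of "int p ^ n"] e[of n]
      by (simp add: le_imp_power_dvd) (metis cong_sym cong_trans)
    then show ?thesis using assms(1) by (simp add: cong_mult_lcancel)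
  qed
  then show thesis
    using assms(2) e
    by (intro that[of "\<lambda>n. e n mod int p ^ n"])
      (auto simp: padic_integers_def cong_def mod_mod_cancel mod_mult_right_eq)
qed

theorem isogenous_imp_gmodule_iso:
  assumes G: "group G" and H: "subgroup H\<^sub>1 G" "subgroup H\<^sub>2 G" and iso: "isogenous G H\<^sub>1 H\<^sub>2 d"
    and p: "0 < p" and d: "coprime d (int p)"
  shows "gmodule_iso (padic_integers p) G (padic_perm_module p G H\<^sub>1) (padic_perm_module p G H\<^sub>2) \<noteq> {}"
proof -
  let ?M\<^sub>1 = "padic_perm_module p G H\<^sub>1" and ?M\<^sub>2 = "padic_perm_module p G H\<^sub>2"
  interpret M\<^sub>2: gmodule "padic_integers p" G ?M\<^sub>2
    by (rule gmodule_perm_module[OF cring_padic_integers[OF p] G H(2)])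
  from iso obtain u v where u: "intertwines G H\<^sub>1 H\<^sub>2 u" and v: "intertwines G H\<^sub>2 H\<^sub>1 v"
    and vu: "\<And>F x. \<lbrakk>left_invariant G H\<^sub>1 F; x \<in> carrier G\<rbrakk> \<Longrightarrow> word_sum G v (word_sum G u F) x = d * F x"
    and uv: "\<And>F x. \<lbrakk>left_invariant G H\<^sub>2 F; x \<in> carrier G\<rbrakk> \<Longrightarrow> word_sum G u (word_sum G v F) x = d * F x"
    unfolding isogenous_def by blast
  obtain e where e: "e \<in> carrier (padic_integers p)" "\<And>n. d * e n mod int p ^ n = 1 mod int p ^ n"
    using padic_integers_inverse[OF d p] by blast
  let ?\<phi> = "coset_map G H\<^sub>1 H\<^sub>2 p u" and ?\<psi> = "coset_map G H\<^sub>2 H\<^sub>1 p v"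
  have "inj_on ?\<phi> (carrier ?M\<^sub>1)"
  proof (rule inj_onI)
    fix f f' assume f: "f \<in> carrier ?M\<^sub>1" "f' \<in> carrier ?M\<^sub>1" and eq: "?\<phi> f = ?\<phi> f'"
    show "f = f'"
    proof (rule level_eqI[OF p f])
      fix n x assume x: "x \<in> carrier G"
      have "[d * level G H\<^sub>1 n f x = d * level G H\<^sub>1 n f' x] (mod int p ^ n)"
        using level_coset_map_coset_map[OF G p H u v vu x, of n f]
          level_coset_map_coset_map[OF G p H u v vu x, of n f'] eq by (simp add: cong_def)
      then show "level G H\<^sub>1 n f x mod int p ^ n = level G H\<^sub>1 n f' x mod int p ^ n"
        using d by (simp add: cong_mult_lcancel cong_def[symmetric])
    qed
  qed
  moreover have "?\<phi> ` carrier ?M\<^sub>1 = carrier ?M\<^sub>2"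
  proof (intro equalityI subsetI)
    fix f assume f: "f \<in> carrier ?M\<^sub>2"
    \<comment> \<open>\<open>?\<phi>\<close> after \<open>?\<psi>\<close> multiplies by
      \<open>d\<close>, and \<open>e\<close> is the inverse of \<open>d\<close>; so
      \<open>?\<psi> ?f\<close> is a preimage of \<open>f\<close>.\<close>
    let ?f = "e \<odot>\<^bsub>?M\<^sub>2\<^esub> f"
    have f': "?f \<in> carrier ?M\<^sub>2" using e(1) f by (rule M\<^sub>2.smult_closed)
    have "?\<phi> (?\<psi> ?f) = f"
    proof (rule level_eqI[OF p _ f])
      show "?\<phi> (?\<psi> ?f) \<in> carrier ?M\<^sub>2"
        using f' by (intro coset_map_closed[OF G p] H u v)
      fix n x assume x: "x \<in> carrier G"
      have "level G H\<^sub>2 n (?\<phi> (?\<psi> ?f)) x = d * (e n * level G H\<^sub>2 n f x mod int p ^ n) mod int p ^ n"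
        using level_coset_map_coset_map[OF G p H(2,1) v u uv x, of n ?f] level_smult[OF G p x] by simp
      also have "\<dots> = (d * e n mod int p ^ n) * level G H\<^sub>2 n f x mod int p ^ n"
        by (simp add: mod_mult_right_eq mod_mult_left_eq mult.assoc)
      also have "\<dots> = level G H\<^sub>2 n f x mod int p ^ n"
        by (simp add: e(2) mod_mult_left_eq)
      finally show "level G H\<^sub>2 n (?\<phi> (?\<psi> ?f)) x mod int p ^ n = level G H\<^sub>2 n f x mod int p ^ n" by simp
    qed
    moreover have "?\<psi> ?f \<in> carrier ?M\<^sub>1" using f' by (rule coset_map_closed[OF G p H(2,1) v])
    ultimately show "f \<in> ?\<phi> ` carrier ?M\<^sub>1" by (metis imageI)
  qed (use coset_map_closed[OF G p H u] in blast)
  ultimately have "?\<phi> \<in> gmodule_iso (padic_integers p) G ?M\<^sub>1 ?M\<^sub>2"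
    using coset_map_add[OF G p H u] coset_map_smult[OF G p H u] coset_map_act[OF G p H u]
    by (simp add: gmodule_iso_def bij_betw_def)
  then show ?thesis by blast
qed

text \<open>Words are pushed forward along \<open>h\<close> and functions pulled back. It is used to
  move the example to a group on natural numbers.\<close>

lemma isogenous_iso_image:
  assumes G: "group G" and G': "group G'" and h: "h \<in> iso G G'"
    and H: "H\<^sub>1 \<subseteq> carrier G" "H\<^sub>2 \<subseteq> carrier G" and iso: "isogenous G H\<^sub>1 H\<^sub>2 d"
  shows "isogenous G' (h ` H\<^sub>1) (h ` H\<^sub>2) d"
proof -
  interpret G: group G by fact
  interpret G': group G' by fact
  have hom: "h x \<in> carrier G'" "h (x \<otimes>\<^bsub>G\<^esub> y) = h x \<otimes>\<^bsub>G'\<^esub> h y"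
    if "x \<in> carrier G" "y \<in> carrier G" for x y
    using h that by (auto simp: iso_def hom_def)
  have surj: "h ` carrier G = carrier G'" using h by (simp add: iso_def bij_betw_def)
  define pull where "pull F x = (if x \<in> carrier G then F (h x) else 0)" for F :: "_ \<Rightarrow> int" and x
  define push where "push u = map (apsnd h) u" for u :: "(int \<times> _) list"
  have pull_inv: "left_invariant G H (pull F)" if "H \<subseteq> carrier G" "left_invariant G' (h ` H) F" for H F
    using that hom by (auto simp: left_invariant_def pull_def subset_iff)
  have pull_word: "pull (word_sum G' (push u) F) = word_sum G u (pull F)"
    if "snd ` set u \<subseteq> carrier G" for u F
  proof
    fix x
    have "map ((\<lambda>a. fst a * F (snd a \<otimes>\<^bsub>G'\<^esub> h x)) \<circ> apsnd h) u
        = map (\<lambda>a. fst a * pull F (snd a \<otimes>\<^bsub>G\<^esub> x)) u" if "x \<in> carrier G"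
      using that \<open>snd ` set u \<subseteq> carrier G\<close> hom by (auto simp: pull_def subset_iff image_iff)
    then show "pull (word_sum G' (push u) F) x = word_sum G u (pull F) x"
      using hom by (simp add: pull_def word_sum_def push_def del: map_eq_conv)
  qed
  have push_int: "intertwines G' (h ` H) (h ` H') (push u)"
    if HH: "H \<subseteq> carrier G" "H' \<subseteq> carrier G" and u: "intertwines G H H' u" for H H' u
    unfolding intertwines_def
  proof (intro conjI allI impI)
    have uc: "snd ` set u \<subseteq> carrier G" using u by (simp add: intertwines_def)
    then show "snd ` set (push u) \<subseteq> carrier G'" using hom by (auto simp: push_def)
    fix F assume "left_invariant G' (h ` H) F"
    then have "left_invariant G H' (pull (word_sum G' (push u) F))"
      using u pull_inv[OF HH(1)] by (simp add: intertwines_def pull_word[OF uc])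
    then have "word_sum G' (push u) F (h k \<otimes>\<^bsub>G'\<^esub> h x) = word_sum G' (push u) F (h x)"
      if "k \<in> H'" "x \<in> carrier G" for k x
      using that HH(2) hom by (auto simp: left_invariant_def pull_def subset_iff)
    then show "left_invariant G' (h ` H') (word_sum G' (push u) F)"
      by (simp add: left_invariant_def flip: surj) (simp add: word_sum_def surj)
  qed
  have push_comp: "word_sum G' (push v) (word_sum G' (push u) F) x = d * F x"
    if "H \<subseteq> carrier G" "snd ` set u \<subseteq> carrier G" "snd ` set v \<subseteq> carrier G"
      "\<forall>F. left_invariant G H F \<longrightarrow> (\<forall>x\<in>carrier G. word_sum G v (word_sum G u F) x = d * F x)"
      "left_invariant G' (h ` H) F" "x \<in> carrier G'" for H u v F x
  proof -
    obtain y where y: "y \<in> carrier G" "x = h y" using \<open>x \<in> carrier G'\<close> surj by blast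
    have "pull (word_sum G' (push v) (word_sum G' (push u) F)) y = d * pull F y"
      using that y(1) pull_inv by (simp add: pull_word)
    then show ?thesis using y by (simp add: pull_def)
  qed
  from iso obtain u v where uv: "intertwines G H\<^sub>1 H\<^sub>2 u" "intertwines G H\<^sub>2 H\<^sub>1 v"
    "\<forall>F. left_invariant G H\<^sub>1 F \<longrightarrow> (\<forall>x\<in>carrier G. word_sum G v (word_sum G u F) x = d * F x)"
    "\<forall>F. left_invariant G H\<^sub>2 F \<longrightarrow> (\<forall>x\<in>carrier G. word_sum G u (word_sum G v F) x = d * F x)"
    unfolding isogenous_def by blast
  have cl: "snd ` set u \<subseteq> carrier G" "snd ` set v \<subseteq> carrier G"
    using uv(1,2) by (simp_all add: intertwines_def)
  show ?thesis
    unfolding isogenous_def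
    using push_int[OF H uv(1)] push_int[OF H(2,1) uv(2)]
      push_comp[OF H(1) cl uv(3)] push_comp[OF H(2) cl(2,1) uv(4)]
    by (intro exI[of _ "push u"] exI[of _ "push v"]) simp
qed

section \<open>The two subgroups\<close>

text \<open>On the first six points live the generators of the wreath product of \<open>S\<^sub>3\<close> with a group of order 2;
  on the other twelve, those of the wreath product of the dihedral group of order 8 with a group of
  order 3, where \<open>\<alpha>\<close>, \<open>\<beta>\<close>, \<open>\<delta>\<close> are cyclic shifts of one triple (reflection, rotation, 1).\<close>

definition \<rho> :: "nat \<Rightarrow> nat" where "\<rho> = id(1 := 2, 2 := 3, 3 := 1)"
definition \<rho>' :: "nat \<Rightarrow> nat" where "\<rho>' = id(4 := 5, 5 := 6, 6 := 4)"
definition \<sigma> :: "nat \<Rightarrow> nat" where "\<sigma> = id(1 := 2, 2 := 1)"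
definition \<zeta> :: "nat \<Rightarrow> nat" where "\<zeta> = id(4 := 5, 5 := 4)"
definition \<nu> :: "nat \<Rightarrow> nat" where "\<nu> = id(1 := 4, 2 := 5, 3 := 6, 4 := 1, 5 := 2, 6 := 3)"
definition \<alpha> :: "nat \<Rightarrow> nat" where "\<alpha> = id(1 := 3, 3 := 1, 5 := 6, 6 := 7, 7 := 8, 8 := 5)"
definition \<beta> :: "nat \<Rightarrow> nat" where "\<beta> = id(5 := 7, 7 := 5, 9 := 10, 10 := 11, 11 := 12, 12 := 9)"
definition \<delta> :: "nat \<Rightarrow> nat" where "\<delta> = id(9 := 11, 11 := 9, 1 := 2, 2 := 3, 3 := 4, 4 := 1)"
text \<open>The half-turns of the three blocks of four points, that is, the central involutions of
  the three dihedral groups. They are the squares of \<open>\<delta>\<close>,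
  \<open>\<alpha>\<close> and \<open>\<beta>\<close> in this order.\<close>

definition \<gamma>\<^sub>1 :: "nat \<Rightarrow> nat" where "\<gamma>\<^sub>1 = id(1 := 3, 2 := 4, 3 := 1, 4 := 2)"
definition \<gamma>\<^sub>2 :: "nat \<Rightarrow> nat" where "\<gamma>\<^sub>2 = id(5 := 7, 6 := 8, 7 := 5, 8 := 6)"
definition \<gamma>\<^sub>3 :: "nat \<Rightarrow> nat" where "\<gamma>\<^sub>3 = id(9 := 11, 10 := 12, 11 := 9, 12 := 10)"
definition \<theta> :: "nat \<Rightarrow> nat" where
  "\<theta> = id(1 := 5, 2 := 6, 3 := 7, 4 := 8, 5 := 9, 6 := 10, 7 := 11, 8 := 12, 9 := 1, 10 := 2, 11 := 3, 12 := 4)"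
lemmas perm_defs = \<rho>_def \<rho>'_def \<sigma>_def \<zeta>_def \<nu>_def \<alpha>_def \<beta>_def \<delta>_def \<gamma>\<^sub>1_def \<gamma>\<^sub>2_def \<gamma>\<^sub>3_def \<theta>_def

text \<open>The relations are oriented towards the normal forms in which \<open>\<rho>\<close>, \<open>\<rho>'\<close>, \<open>\<sigma>\<close>, \<open>\<zeta>\<close>, \<open>\<nu>\<close>, respectively
  the \<open>\<gamma>\<close>, \<open>\<alpha>\<close>, \<open>\<beta>\<close>, \<open>\<delta>\<close>, \<open>\<theta>\<close>, occur in this order.\<close>

lemma relations1:
  "\<rho> \<circ> (\<rho> \<circ> (\<rho> \<circ> x)) = x" "\<rho>' \<circ> (\<rho>' \<circ> (\<rho>' \<circ> x)) = x"
  "\<sigma> \<circ> (\<sigma> \<circ> x) = x" "\<zeta> \<circ> (\<zeta> \<circ> x) = x" "\<nu> \<circ> (\<nu> \<circ> x) = x"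
  "\<rho>' \<circ> (\<rho> \<circ> x) = \<rho> \<circ> (\<rho>' \<circ> x)" "\<sigma> \<circ> (\<rho> \<circ> x) = \<rho> \<circ> (\<rho> \<circ> (\<sigma> \<circ> x))"
  "\<zeta> \<circ> (\<rho> \<circ> x) = \<rho> \<circ> (\<zeta> \<circ> x)" "\<nu> \<circ> (\<rho> \<circ> x) = \<rho>' \<circ> (\<nu> \<circ> x)"
  "\<sigma> \<circ> (\<rho>' \<circ> x) = \<rho>' \<circ> (\<sigma> \<circ> x)" "\<zeta> \<circ> (\<rho>' \<circ> x) = \<rho>' \<circ> (\<rho>' \<circ> (\<zeta> \<circ> x))"
  "\<nu> \<circ> (\<rho>' \<circ> x) = \<rho> \<circ> (\<nu> \<circ> x)"
  "\<zeta> \<circ> (\<sigma> \<circ> x) = \<sigma> \<circ> (\<zeta> \<circ> x)" "\<nu> \<circ> (\<sigma> \<circ> x) = \<zeta> \<circ> (\<nu> \<circ> x)"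
  "\<nu> \<circ> (\<zeta> \<circ> x) = \<sigma> \<circ> (\<nu> \<circ> x)"
  by (simp_all add: perm_defs fun_eq_iff)

lemma relations2:
  "\<gamma>\<^sub>1 \<circ> (\<gamma>\<^sub>1 \<circ> x) = x" "\<gamma>\<^sub>2 \<circ> (\<gamma>\<^sub>2 \<circ> x) = x" "\<gamma>\<^sub>3 \<circ> (\<gamma>\<^sub>3 \<circ> x) = x"
  "\<gamma>\<^sub>2 \<circ> (\<gamma>\<^sub>1 \<circ> x) = \<gamma>\<^sub>1 \<circ> (\<gamma>\<^sub>2 \<circ> x)" "\<gamma>\<^sub>3 \<circ> (\<gamma>\<^sub>1 \<circ> x) = \<gamma>\<^sub>1 \<circ> (\<gamma>\<^sub>3 \<circ> x)"
  "\<gamma>\<^sub>3 \<circ> (\<gamma>\<^sub>2 \<circ> x) = \<gamma>\<^sub>2 \<circ> (\<gamma>\<^sub>3 \<circ> x)"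
  "\<alpha> \<circ> (\<gamma>\<^sub>1 \<circ> x) = \<gamma>\<^sub>1 \<circ> (\<alpha> \<circ> x)" "\<alpha> \<circ> (\<gamma>\<^sub>2 \<circ> x) = \<gamma>\<^sub>2 \<circ> (\<alpha> \<circ> x)"
  "\<alpha> \<circ> (\<gamma>\<^sub>3 \<circ> x) = \<gamma>\<^sub>3 \<circ> (\<alpha> \<circ> x)"
  "\<beta> \<circ> (\<gamma>\<^sub>1 \<circ> x) = \<gamma>\<^sub>1 \<circ> (\<beta> \<circ> x)" "\<beta> \<circ> (\<gamma>\<^sub>2 \<circ> x) = \<gamma>\<^sub>2 \<circ> (\<beta> \<circ> x)"
  "\<beta> \<circ> (\<gamma>\<^sub>3 \<circ> x) = \<gamma>\<^sub>3 \<circ> (\<beta> \<circ> x)"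
  "\<delta> \<circ> (\<gamma>\<^sub>1 \<circ> x) = \<gamma>\<^sub>1 \<circ> (\<delta> \<circ> x)" "\<delta> \<circ> (\<gamma>\<^sub>2 \<circ> x) = \<gamma>\<^sub>2 \<circ> (\<delta> \<circ> x)"
  "\<delta> \<circ> (\<gamma>\<^sub>3 \<circ> x) = \<gamma>\<^sub>3 \<circ> (\<delta> \<circ> x)"
  by (simp_all add: perm_defs fun_eq_iff)

lemma relations3:
  "\<alpha> \<circ> (\<alpha> \<circ> x) = \<gamma>\<^sub>2 \<circ> x" "\<beta> \<circ> (\<beta> \<circ> x) = \<gamma>\<^sub>3 \<circ> x" "\<delta> \<circ> (\<delta> \<circ> x) = \<gamma>\<^sub>1 \<circ> x"
  "\<beta> \<circ> (\<alpha> \<circ> x) = \<gamma>\<^sub>2 \<circ> (\<alpha> \<circ> (\<beta> \<circ> x))" "\<delta> \<circ> (\<beta> \<circ> x) = \<gamma>\<^sub>3 \<circ> (\<beta> \<circ> (\<delta> \<circ> x))"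
  "\<delta> \<circ> (\<alpha> \<circ> x) = \<gamma>\<^sub>1 \<circ> (\<alpha> \<circ> (\<delta> \<circ> x))"
  by (simp_all add: perm_defs fun_eq_iff)

lemma relations4:
  "\<theta> \<circ> (\<theta> \<circ> (\<theta> \<circ> x)) = x"
  "\<theta> \<circ> (\<gamma>\<^sub>1 \<circ> x) = \<gamma>\<^sub>2 \<circ> (\<theta> \<circ> x)" "\<theta> \<circ> (\<gamma>\<^sub>2 \<circ> x) = \<gamma>\<^sub>3 \<circ> (\<theta> \<circ> x)" "\<theta> \<circ> (\<gamma>\<^sub>3 \<circ> x) = \<gamma>\<^sub>1 \<circ> (\<theta> \<circ> x)"
  "\<theta> \<circ> (\<alpha> \<circ> x) = \<beta> \<circ> (\<theta> \<circ> x)" "\<theta> \<circ> (\<beta> \<circ> x) = \<delta> \<circ> (\<theta> \<circ> x)" "\<theta> \<circ> (\<delta> \<circ> x) = \<alpha> \<circ> (\<theta> \<circ> x)"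
  by (simp_all add: perm_defs fun_eq_iff)
lemmas relations = relations1 relations2 relations3 relations4

text \<open>The trailing \<open>x\<close> lets the relations rewrite inside right-nested composites;
  these instances treat a redex at the right end.\<close>

lemmas relations_id = relations[where x = id, unfolded comp_id]

text \<open>The ambient group has to contain all words of both isogenies. With full symmetric
  groups, membership only requires permuting the points.\<close>

definition \<Gamma> :: "((nat \<Rightarrow> nat) \<times> (nat \<Rightarrow> nat)) monoid" where
  "\<Gamma> = sym_group 6 \<times>\<times> sym_group 12"

definition H\<^sub>1 :: "((nat \<Rightarrow> nat) \<times> (nat \<Rightarrow> nat)) set" where
  "H\<^sub>1 = generate \<Gamma> {(\<rho>, id), (\<zeta>, \<alpha>), (\<sigma>, \<beta>), (id, \<gamma>\<^sub>1), (id, \<gamma>\<^sub>2), (id, \<gamma>\<^sub>3)}"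

definition H\<^sub>2 :: "((nat \<Rightarrow> nat) \<times> (nat \<Rightarrow> nat)) set" where
  "H\<^sub>2 = generate \<Gamma> {(\<rho>, id), (\<sigma>, \<alpha>), (\<zeta>, \<beta>), (id, \<gamma>\<^sub>1), (id, \<gamma>\<^sub>2), (id, \<gamma>\<^sub>3)}"

section \<open>Membership and left translation in the ambient group\<close>

lemma group_\<Gamma>: "group \<Gamma>"
  by (simp add: \<Gamma>_def DirProd_group sym_group_is_group)

interpretation \<Gamma>: group \<Gamma>
  by (rule group_\<Gamma>)

lemma carrier_\<Gamma>: "carrier \<Gamma> = {(g, y). g permutes {1..6} \<and> y permutes {1..12}}"
  by (auto simp: \<Gamma>_def DirProd_def sym_group_def)

lemma mult_\<Gamma> [simp]: "(g, y) \<otimes>\<^bsub>\<Gamma>\<^esub> (g', y') = (g \<circ> g', y \<circ> y')"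
  by (simp add: \<Gamma>_def DirProd_def sym_group_def)

lemma one_\<Gamma> [simp]: "\<one>\<^bsub>\<Gamma>\<^esub> = (id, id)"
  by (simp add: \<Gamma>_def DirProd_def sym_group_def)

lemma finite_\<Gamma>: "finite (carrier \<Gamma>)"
  by (simp add: \<Gamma>_def DirProd_def sym_group_def finite_permutations)

lemma permutesI_inverse:
  assumes "p \<circ> q = id" "q \<circ> p = id" "\<And>x. x \<notin> S \<Longrightarrow> p x = x"
  shows "p permutes S"
  unfolding permutes_def using assms(3) o_bij[OF assms(2,1)] by (simp add: bij_iff)

lemma permutes_6:
  "\<rho> permutes {1..6}" "\<rho>' permutes {1..6}" "\<sigma> permutes {1..6}" "\<zeta> permutes {1..6}" "\<nu> permutes {1..6}"
proof -
  show "\<rho> permutes {1..6}"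
    by (rule permutesI_inverse[of _ "\<rho> \<circ> \<rho>"]) (auto simp: relations_id o_assoc[symmetric] \<rho>_def)
  show "\<rho>' permutes {1..6}"
    by (rule permutesI_inverse[of _ "\<rho>' \<circ> \<rho>'"]) (auto simp: relations_id o_assoc[symmetric] \<rho>'_def)
  show "\<sigma> permutes {1..6}" "\<zeta> permutes {1..6}" "\<nu> permutes {1..6}"
    by (rule permutesI_inverse; (rule relations_id)?; auto simp: perm_defs)+
qed

lemma permutes_12:
  "\<alpha> permutes {1..12}" "\<beta> permutes {1..12}" "\<theta> permutes {1..12}"
  "\<gamma>\<^sub>1 permutes {1..12}" "\<gamma>\<^sub>2 permutes {1..12}" "\<gamma>\<^sub>3 permutes {1..12}"
proof -
  show "\<gamma>\<^sub>1 permutes {1..12}" "\<gamma>\<^sub>2 permutes {1..12}" "\<gamma>\<^sub>3 permutes {1..12}"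
    by (rule permutesI_inverse; (rule relations_id)?; auto simp: perm_defs)+
  show "\<alpha> permutes {1..12}"
    by (rule permutesI_inverse[of _ "\<gamma>\<^sub>2 \<circ> \<alpha>"])
      (auto simp: relations relations_id o_assoc[symmetric], auto simp: \<alpha>_def)
  show "\<beta> permutes {1..12}"
    by (rule permutesI_inverse[of _ "\<gamma>\<^sub>3 \<circ> \<beta>"])
      (auto simp: relations relations_id o_assoc[symmetric], auto simp: \<beta>_def)
  show "\<theta> permutes {1..12}"
    by (rule permutesI_inverse[of _ "\<theta> \<circ> \<theta>"])
      (auto simp: relations relations_id o_assoc[symmetric], auto simp: \<theta>_def)
qed

lemmas carrier_simps = carrier_\<Gamma> permutes_6 permutes_12 permutes_compose permutes_id

lemma gens_closed:
  "{(\<rho>, id), (\<zeta>, \<alpha>), (\<sigma>, \<beta>), (id, \<gamma>\<^sub>1), (id, \<gamma>\<^sub>2), (id, \<gamma>\<^sub>3)} \<subseteq> carrier \<Gamma>"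
  "{(\<rho>, id), (\<sigma>, \<alpha>), (\<zeta>, \<beta>), (id, \<gamma>\<^sub>1), (id, \<gamma>\<^sub>2), (id, \<gamma>\<^sub>3)} \<subseteq> carrier \<Gamma>"
  by (simp_all add: carrier_simps del: One_nat_def)

lemma subgroup_H: "subgroup H\<^sub>1 \<Gamma>" "subgroup H\<^sub>2 \<Gamma>"
  unfolding H\<^sub>1_def H\<^sub>2_def by (intro \<Gamma>.generate_is_subgroup gens_closed)+

text \<open>Translation by a group element neither enters nor leaves the carrier. Since invariant
  functions vanish outside it, their equations become unconditional rewrite rules.\<close>

lemma comp_in_carrier_iff:
  assumes "(g, y) \<in> carrier \<Gamma>"
  shows "(g \<circ> g', y \<circ> y') \<in> carrier \<Gamma> \<longleftrightarrow> (g', y') \<in> carrier \<Gamma>"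
proof
  assume *: "(g \<circ> g', y \<circ> y') \<in> carrier \<Gamma>"
  from assms have p: "g permutes {1..6}" "y permutes {1..12}" by (simp_all add: carrier_\<Gamma>)
  have "inv_into UNIV g \<circ> (g \<circ> g') = g'" "inv_into UNIV y \<circ> (y \<circ> y') = y'"
    using p by (simp_all add: o_assoc permutes_inv_o)
  with * p show "(g', y') \<in> carrier \<Gamma>"
    using permutes_compose[OF _ permutes_inv[OF p(1)], of "g \<circ> g'"]
      permutes_compose[OF _ permutes_inv[OF p(2)], of "y \<circ> y'"] by (simp add: carrier_\<Gamma>)
qed (use assms in \<open>auto simp: carrier_\<Gamma> permutes_compose\<close>)

lemma left_invariant_comp:
  assumes "left_invariant \<Gamma> H F" "(g, y) \<in> H" "H \<subseteq> carrier \<Gamma>"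
  shows "F (g \<circ> g', y \<circ> y') = F (g', y')"
  using assms comp_in_carrier_iff[of g y g' y'] by (fastforce simp: left_invariant_def)

lemma word_sum_\<Gamma>:
  assumes F: "left_invariant \<Gamma> H F" and u: "snd ` set u \<subseteq> carrier \<Gamma>"
  shows "word_sum \<Gamma> u F (g, y) = (\<Sum>a\<leftarrow>u. fst a * F (fst (snd a) \<circ> g, snd (snd a) \<circ> y))"
proof (cases "(g, y) \<in> carrier \<Gamma>")
  case True
  have "a \<otimes>\<^bsub>\<Gamma>\<^esub> (g, y) = (fst a \<circ> g, snd a \<circ> y)" for a by (cases a) simp
  then show ?thesis using True by (simp add: word_sum_def)
next
  case False
  have "fst a * F (fst (snd a) \<circ> g, snd (snd a) \<circ> y) = 0" if "a \<in> set u" for a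
  proof -
    have "snd a \<in> carrier \<Gamma>" using u that by blast
    then have "(fst (snd a) \<circ> g, snd (snd a) \<circ> y) \<notin> carrier \<Gamma>"
      using False comp_in_carrier_iff[of "fst (snd a)" "snd (snd a)"] by simp
    then show ?thesis using F by (simp add: left_invariant_def)
  qed
  then have "map (\<lambda>a. fst a * F (fst (snd a) \<circ> g, snd (snd a) \<circ> y)) u = map (\<lambda>a. 0) u" by simp
  then show ?thesis using False by (simp add: word_sum_def del: map_eq_conv)
qed

text \<open>As rewrite rules these erase \<open>\<rho>\<close> and the central involutions, and
  trade a leading \<open>\<alpha>\<close> or \<open>\<beta>\<close> for \<open>\<zeta>\<close> or
  \<open>\<sigma>\<close> in the first coordinate, which is possible because the latter are
  involutions.\<close>

lemma invariant_H\<^sub>1: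
  assumes "left_invariant \<Gamma> H\<^sub>1 F"
  shows "F (\<rho> \<circ> g, y) = F (g, y)" "F (g, \<alpha> \<circ> y) = F (\<zeta> \<circ> g, y)" "F (g, \<beta> \<circ> y) = F (\<sigma> \<circ> g, y)"
    "F (g, \<gamma>\<^sub>1 \<circ> y) = F (g, y)" "F (g, \<gamma>\<^sub>2 \<circ> y) = F (g, y)" "F (g, \<gamma>\<^sub>3 \<circ> y) = F (g, y)"
proof -
  have *: "F (a \<circ> g, b \<circ> y) = F (g, y)"
    if "(a, b) \<in> {(\<rho>, id), (\<zeta>, \<alpha>), (\<sigma>, \<beta>), (id, \<gamma>\<^sub>1), (id, \<gamma>\<^sub>2), (id, \<gamma>\<^sub>3)}" for a b g y
    using that assms subgroup.subset[OF subgroup_H(1)]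
    by (intro left_invariant_comp[of H\<^sub>1]) (auto simp: H\<^sub>1_def intro: generate.incl)
  show "F (\<rho> \<circ> g, y) = F (g, y)" "F (g, \<gamma>\<^sub>1 \<circ> y) = F (g, y)" "F (g, \<gamma>\<^sub>2 \<circ> y) = F (g, y)"
    "F (g, \<gamma>\<^sub>3 \<circ> y) = F (g, y)"
    using *[of \<rho> id] *[of id] by auto
  show "F (g, \<alpha> \<circ> y) = F (\<zeta> \<circ> g, y)" "F (g, \<beta> \<circ> y) = F (\<sigma> \<circ> g, y)"
    using *[of \<zeta> \<alpha> "\<zeta> \<circ> g" y] *[of \<sigma> \<beta> "\<sigma> \<circ> g" y] by (simp_all add: relations)
qed

lemma invariant_H\<^sub>2:
  assumes "left_invariant \<Gamma> H\<^sub>2 F"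
  shows "F (\<rho> \<circ> g, y) = F (g, y)" "F (g, \<alpha> \<circ> y) = F (\<sigma> \<circ> g, y)" "F (g, \<beta> \<circ> y) = F (\<zeta> \<circ> g, y)"
    "F (g, \<gamma>\<^sub>1 \<circ> y) = F (g, y)" "F (g, \<gamma>\<^sub>2 \<circ> y) = F (g, y)" "F (g, \<gamma>\<^sub>3 \<circ> y) = F (g, y)"
proof -
  have *: "F (a \<circ> g, b \<circ> y) = F (g, y)"
    if "(a, b) \<in> {(\<rho>, id), (\<sigma>, \<alpha>), (\<zeta>, \<beta>), (id, \<gamma>\<^sub>1), (id, \<gamma>\<^sub>2), (id, \<gamma>\<^sub>3)}" for a b g y
    using that assms subgroup.subset[OF subgroup_H(2)]
    by (intro left_invariant_comp[of H\<^sub>2]) (auto simp: H\<^sub>2_def intro: generate.incl)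
  show "F (\<rho> \<circ> g, y) = F (g, y)" "F (g, \<gamma>\<^sub>1 \<circ> y) = F (g, y)" "F (g, \<gamma>\<^sub>2 \<circ> y) = F (g, y)"
    "F (g, \<gamma>\<^sub>3 \<circ> y) = F (g, y)"
    using *[of \<rho> id] *[of id] by auto
  show "F (g, \<alpha> \<circ> y) = F (\<sigma> \<circ> g, y)" "F (g, \<beta> \<circ> y) = F (\<zeta> \<circ> g, y)"
    using *[of \<sigma> \<alpha> "\<sigma> \<circ> g" y] *[of \<zeta> \<beta> "\<zeta> \<circ> g" y] by (simp_all add: relations)
qed

lemma left_invariant_H:
  assumes "\<And>g y. F (\<rho> \<circ> g, y) = F (g, y)" "\<And>g y. F (g, \<gamma>\<^sub>1 \<circ> y) = F (g, y)"
    "\<And>g y. F (g, \<gamma>\<^sub>2 \<circ> y) = F (g, y)" "\<And>g y. F (g, \<gamma>\<^sub>3 \<circ> y) = F (g, y)"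
    and "\<And>x. x \<notin> carrier \<Gamma> \<Longrightarrow> F x = 0"
  shows "\<lbrakk>\<And>g y. F (\<zeta> \<circ> g, \<alpha> \<circ> y) = F (g, y); \<And>g y. F (\<sigma> \<circ> g, \<beta> \<circ> y) = F (g, y)\<rbrakk>
      \<Longrightarrow> left_invariant \<Gamma> H\<^sub>1 F"
    and "\<lbrakk>\<And>g y. F (\<sigma> \<circ> g, \<alpha> \<circ> y) = F (g, y); \<And>g y. F (\<zeta> \<circ> g, \<beta> \<circ> y) = F (g, y)\<rbrakk>
      \<Longrightarrow> left_invariant \<Gamma> H\<^sub>2 F"
proof -
  show "left_invariant \<Gamma> H\<^sub>1 F"
    if "\<And>g y. F (\<zeta> \<circ> g, \<alpha> \<circ> y) = F (g, y)" "\<And>g y. F (\<sigma> \<circ> g, \<beta> \<circ> y) = F (g, y)"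
    unfolding H\<^sub>1_def
  proof (rule \<Gamma>.left_invariant_generate[OF gens_closed(1) _ assms(5)])
    fix s x assume "s \<in> {(\<rho>, id), (\<zeta>, \<alpha>), (\<sigma>, \<beta>), (id, \<gamma>\<^sub>1), (id, \<gamma>\<^sub>2), (id, \<gamma>\<^sub>3)}"
    then show "F (s \<otimes>\<^bsub>\<Gamma>\<^esub> x) = F x" using assms(1-4) that by (cases x) auto
  qed
  show "left_invariant \<Gamma> H\<^sub>2 F"
    if "\<And>g y. F (\<sigma> \<circ> g, \<alpha> \<circ> y) = F (g, y)" "\<And>g y. F (\<zeta> \<circ> g, \<beta> \<circ> y) = F (g, y)"
    unfolding H\<^sub>2_def
  proof (rule \<Gamma>.left_invariant_generate[OF gens_closed(2) _ assms(5)])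
    fix s x assume "s \<in> {(\<rho>, id), (\<sigma>, \<alpha>), (\<zeta>, \<beta>), (id, \<gamma>\<^sub>1), (id, \<gamma>\<^sub>2), (id, \<gamma>\<^sub>3)}"
    then show "F (s \<otimes>\<^bsub>\<Gamma>\<^esub> x) = F x" using assms(1-4) that by (cases x) auto
  qed
qed

section \<open>The intertwining translations\<close>

text \<open>After inverting 3, the invariants of \<open>H\<^sub>1\<close> split into the part fixed by \<open>\<rho>'\<close> and a complement. The
  first three words transport the former by \<open>\<nu>\<close>. On the complement the group ring of \<open>\<langle>\<rho>', \<zeta>\<rangle>\<close> is a
  full matrix ring of size 2; the other words transport it by \<open>\<theta>\<close>, composed with three times a
  matrix unit \<open>(1 - \<rho>'\<^sup>2)(1 + \<zeta>\<rho>')\<close> and with the trace \<open>1 + \<zeta>\<beta>\<close> that restores invariance.\<close>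

definition words_two :: "(nat \<Rightarrow> nat) \<Rightarrow> (nat \<Rightarrow> nat) \<Rightarrow> (int \<times> (nat \<Rightarrow> nat) \<times> (nat \<Rightarrow> nat)) list" where
  "words_two t b =
    [(1, \<nu>, id), (1, \<nu> \<circ> \<rho>, id), (1, \<nu> \<circ> (\<rho> \<circ> \<rho>), id),
     (1, id, t), (1, \<zeta>, t \<circ> b), (- 1, \<rho>' \<circ> \<rho>', t), (- 1, \<rho>' \<circ> (\<rho>' \<circ> \<zeta>), t \<circ> b),
     (1, \<zeta> \<circ> \<rho>', t), (1, \<zeta> \<circ> (\<rho>' \<circ> \<zeta>), t \<circ> b),
     (- 1, \<zeta> \<circ> (\<rho>' \<circ> \<rho>'), t), (- 1, \<zeta> \<circ> (\<rho>' \<circ> (\<rho>' \<circ> \<zeta>)), t \<circ> b)]"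

text \<open>After inverting 2 the invariants split according to the signs of \<open>\<sigma>\<close>, \<open>\<zeta>\<close> and \<open>\<delta>\<close>. The identity
  serves where \<open>\<sigma> = \<zeta>\<close>, and where \<open>\<sigma> = - \<zeta>\<close> one of \<open>\<theta>\<close> and its inverse matches the characters of
  \<open>\<langle>\<alpha>, \<beta>, \<delta>\<rangle>\<close> on both sides.\<close>

definition words_odd ::
    "(nat \<Rightarrow> nat) \<Rightarrow> (nat \<Rightarrow> nat) \<Rightarrow> (nat \<Rightarrow> nat) \<Rightarrow> (nat \<Rightarrow> nat) \<Rightarrow> (int \<times> (nat \<Rightarrow> nat) \<times> (nat \<Rightarrow> nat)) list" where
  "words_odd t t' a b =
    [(2, id, id), (2, \<sigma> \<circ> \<zeta>, id),
     (1, id, t'), (1, \<sigma>, t' \<circ> a), (- 1, \<sigma> \<circ> \<zeta>, t'), (- 1, \<zeta>, t' \<circ> a),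
     (1, id, t), (1, \<zeta>, t \<circ> b), (- 1, \<sigma> \<circ> \<zeta>, t), (- 1, \<sigma>, t \<circ> b)]"

section \<open>Verification of the isogenies of degree 9 and 16\<close>

lemma words_closed:
  assumes "t permutes {1..12}" "t' permutes {1..12}" "a permutes {1..12}" "b permutes {1..12}"
  shows "snd ` set (words_two t b) \<subseteq> carrier \<Gamma>" "snd ` set (words_odd t t' a b) \<subseteq> carrier \<Gamma>"
  using assms by (simp_all add: words_two_def words_odd_def carrier_simps del: One_nat_def)

lemma word_sum_words_two:
  assumes "left_invariant \<Gamma> H F" "t permutes {1..12}" "b permutes {1..12}"
  shows "word_sum \<Gamma> (words_two t b) F (g, y) =
    F (\<nu> \<circ> g, y) + F (\<nu> \<circ> (\<rho> \<circ> g), y) + F (\<nu> \<circ> (\<rho> \<circ> (\<rho> \<circ> g)), y)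
    + F (g, t \<circ> y) + F (\<zeta> \<circ> g, t \<circ> (b \<circ> y))
    - F (\<rho>' \<circ> (\<rho>' \<circ> g), t \<circ> y) - F (\<rho>' \<circ> (\<rho>' \<circ> (\<zeta> \<circ> g)), t \<circ> (b \<circ> y))
    + F (\<zeta> \<circ> (\<rho>' \<circ> g), t \<circ> y) + F (\<zeta> \<circ> (\<rho>' \<circ> (\<zeta> \<circ> g)), t \<circ> (b \<circ> y))
    - F (\<zeta> \<circ> (\<rho>' \<circ> (\<rho>' \<circ> g)), t \<circ> y) - F (\<zeta> \<circ> (\<rho>' \<circ> (\<rho>' \<circ> (\<zeta> \<circ> g))), t \<circ> (b \<circ> y))"
  by (subst word_sum_\<Gamma>[OF assms(1) words_closed(1)[OF assms(2,2,3,3)]])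
    (simp add: words_two_def comp_assoc)

lemma word_sum_words_odd:
  assumes "left_invariant \<Gamma> H F" "t permutes {1..12}" "t' permutes {1..12}" "a permutes {1..12}" "b permutes {1..12}"
  shows "word_sum \<Gamma> (words_odd t t' a b) F (g, y) =
    2 * F (g, y) + 2 * F (\<sigma> \<circ> (\<zeta> \<circ> g), y)
    + F (g, t' \<circ> y) + F (\<sigma> \<circ> g, t' \<circ> (a \<circ> y)) - F (\<sigma> \<circ> (\<zeta> \<circ> g), t' \<circ> y) - F (\<zeta> \<circ> g, t' \<circ> (a \<circ> y))
    + F (g, t \<circ> y) + F (\<zeta> \<circ> g, t \<circ> (b \<circ> y)) - F (\<sigma> \<circ> (\<zeta> \<circ> g), t \<circ> y) - F (\<sigma> \<circ> g, t \<circ> (b \<circ> y))"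
  by (subst word_sum_\<Gamma>[OF assms(1) words_closed(2)[OF assms(2-5)]])
    (simp add: words_odd_def comp_assoc)

lemma permutes_\<theta>_\<theta>: "\<theta> \<circ> \<theta> permutes {1..12}"
  by (intro permutes_compose permutes_12)

text \<open>After rewriting to normal form, each generator of the target subgroup merely permutes
  the eleven terms, signs included.\<close>

lemma intertwines_words_two:
  "intertwines \<Gamma> H\<^sub>1 H\<^sub>2 (words_two \<theta> \<beta>)" "intertwines \<Gamma> H\<^sub>2 H\<^sub>1 (words_two (\<theta> \<circ> \<theta>) \<alpha>)"
proof -
  note perms = permutes_12 permutes_\<theta>_\<theta>
  have "left_invariant \<Gamma> H\<^sub>2 (word_sum \<Gamma> (words_two \<theta> \<beta>) F)" if F: "left_invariant \<Gamma> H\<^sub>1 F" for F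
  proof (rule left_invariant_H(2))
    show "word_sum \<Gamma> (words_two \<theta> \<beta>) F x = 0" if "x \<notin> carrier \<Gamma>" for x
      using that by (simp add: word_sum_def)
  qed (simp_all add: word_sum_words_two[OF F perms(3,2)] relations invariant_H\<^sub>1[OF F])
  then show "intertwines \<Gamma> H\<^sub>1 H\<^sub>2 (words_two \<theta> \<beta>)"
    using words_closed(1)[OF perms(3,3,2,2)] by (simp add: intertwines_def)
  have "left_invariant \<Gamma> H\<^sub>1 (word_sum \<Gamma> (words_two (\<theta> \<circ> \<theta>) \<alpha>) F)" if F: "left_invariant \<Gamma> H\<^sub>2 F" for F
  proof (rule left_invariant_H(1))
    show "word_sum \<Gamma> (words_two (\<theta> \<circ> \<theta>) \<alpha>) F x = 0" if "x \<notin> carrier \<Gamma>" for x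
      using that by (simp add: word_sum_def)
  qed (simp_all add: word_sum_words_two[OF F perms(7,1)] comp_assoc relations invariant_H\<^sub>2[OF F])
  then show "intertwines \<Gamma> H\<^sub>2 H\<^sub>1 (words_two (\<theta> \<circ> \<theta>) \<alpha>)"
    using words_closed(1)[OF perms(7,7,1,1)] by (simp add: intertwines_def)
qed

lemma intertwines_words_odd:
  "intertwines \<Gamma> H\<^sub>1 H\<^sub>2 (words_odd \<theta> (\<theta> \<circ> \<theta>) \<alpha> \<beta>)" "intertwines \<Gamma> H\<^sub>2 H\<^sub>1 (words_odd (\<theta> \<circ> \<theta>) \<theta> \<beta> \<alpha>)"
proof -
  note perms = permutes_12 permutes_\<theta>_\<theta>
  have "left_invariant \<Gamma> H\<^sub>2 (word_sum \<Gamma> (words_odd \<theta> (\<theta> \<circ> \<theta>) \<alpha> \<beta>) F)"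
    if F: "left_invariant \<Gamma> H\<^sub>1 F" for F
  proof (rule left_invariant_H(2))
    show "word_sum \<Gamma> (words_odd \<theta> (\<theta> \<circ> \<theta>) \<alpha> \<beta>) F x = 0" if "x \<notin> carrier \<Gamma>" for x
      using that by (simp add: word_sum_def)
  qed (simp_all add: word_sum_words_odd[OF F perms(3,7,1,2)] comp_assoc relations invariant_H\<^sub>1[OF F])
  then show "intertwines \<Gamma> H\<^sub>1 H\<^sub>2 (words_odd \<theta> (\<theta> \<circ> \<theta>) \<alpha> \<beta>)"
    using words_closed(2)[OF perms(3,7,1,2)] by (simp add: intertwines_def)
  have "left_invariant \<Gamma> H\<^sub>1 (word_sum \<Gamma> (words_odd (\<theta> \<circ> \<theta>) \<theta> \<beta> \<alpha>) F)"
    if F: "left_invariant \<Gamma> H\<^sub>2 F" for F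
  proof (rule left_invariant_H(1))
    show "word_sum \<Gamma> (words_odd (\<theta> \<circ> \<theta>) \<theta> \<beta> \<alpha>) F x = 0" if "x \<notin> carrier \<Gamma>" for x
      using that by (simp add: word_sum_def)
  qed (simp_all add: word_sum_words_odd[OF F perms(7,3,2,1)] comp_assoc relations invariant_H\<^sub>2[OF F])
  then show "intertwines \<Gamma> H\<^sub>2 H\<^sub>1 (words_odd (\<theta> \<circ> \<theta>) \<theta> \<beta> \<alpha>)"
    using words_closed(2)[OF perms(7,3,2,1)] by (simp add: intertwines_def)
qed

text \<open>On invariants the \<open>\<nu>\<close>-words of both factors compose to 3 times the sum
  of the powers of \<open>\<rho>'\<close>, which is 9 on the part fixed by \<open>\<rho>'\<close>
  and 0 on the complement. Mixed terms cancel, and the remaining words supply the 9 on the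
  complement.\<close>

lemma isogenous_9: "isogenous \<Gamma> H\<^sub>1 H\<^sub>2 9"
proof -
  note perms = permutes_12 permutes_\<theta>_\<theta>
  have "word_sum \<Gamma> (words_two (\<theta> \<circ> \<theta>) \<alpha>) (word_sum \<Gamma> (words_two \<theta> \<beta>) F) (g, y) = 9 * F (g, y)"
    if F: "left_invariant \<Gamma> H\<^sub>1 F" for F g y
  proof -
    have F': "left_invariant \<Gamma> H\<^sub>2 (word_sum \<Gamma> (words_two \<theta> \<beta>) F)"
      using intertwines_words_two(1) F by (simp add: intertwines_def)
    show ?thesis
      by (simp add: word_sum_words_two[OF F' perms(7,1)])
         (simp add: word_sum_words_two[OF F perms(3,2)] comp_assoc relations invariant_H\<^sub>1[OF F])
  qed
  moreover have "word_sum \<Gamma> (words_two \<theta> \<beta>) (word_sum \<Gamma> (words_two (\<theta> \<circ> \<theta>) \<alpha>) F) (g, y) = 9 * F (g, y)"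
    if F: "left_invariant \<Gamma> H\<^sub>2 F" for F g y
  proof -
    have F': "left_invariant \<Gamma> H\<^sub>1 (word_sum \<Gamma> (words_two (\<theta> \<circ> \<theta>) \<alpha>) F)"
      using intertwines_words_two(2) F by (simp add: intertwines_def)
    show ?thesis
      by (simp add: word_sum_words_two[OF F' perms(3,2)])
         (simp add: word_sum_words_two[OF F perms(7,1)] comp_assoc relations invariant_H\<^sub>2[OF F])
  qed
  ultimately show ?thesis
    unfolding isogenous_def using intertwines_words_two by fast
qed

text \<open>The first two words square to \<open>8 * (1 + \<sigma>\<zeta>)\<close>, the others
  compose to \<open>8 * (1 - \<sigma>\<zeta>)\<close>, and mixed terms cancel because they contain
  the product of \<open>1 + \<sigma>\<zeta>\<close> and \<open>1 - \<sigma>\<zeta>\<close>.\<close>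

lemma isogenous_16: "isogenous \<Gamma> H\<^sub>1 H\<^sub>2 16"
proof -
  note perms = permutes_12 permutes_\<theta>_\<theta>
  let ?u = "words_odd \<theta> (\<theta> \<circ> \<theta>) \<alpha> \<beta>" and ?v = "words_odd (\<theta> \<circ> \<theta>) \<theta> \<beta> \<alpha>"
  have "word_sum \<Gamma> ?v (word_sum \<Gamma> ?u F) (g, y) = 16 * F (g, y)"
    if F: "left_invariant \<Gamma> H\<^sub>1 F" for F g y
  proof -
    have F': "left_invariant \<Gamma> H\<^sub>2 (word_sum \<Gamma> ?u F)"
      using intertwines_words_odd(1) F by (simp add: intertwines_def)
    show ?thesis
      by (simp add: word_sum_words_odd[OF F' perms(7,3,2,1)])
         (simp add: word_sum_words_odd[OF F perms(3,7,1,2)] comp_assoc relations invariant_H\<^sub>1[OF F])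
  qed
  moreover have "word_sum \<Gamma> ?u (word_sum \<Gamma> ?v F) (g, y) = 16 * F (g, y)"
    if F: "left_invariant \<Gamma> H\<^sub>2 F" for F g y
  proof -
    have F': "left_invariant \<Gamma> H\<^sub>1 (word_sum \<Gamma> ?v F)"
      using intertwines_words_odd(2) F by (simp add: intertwines_def)
    show ?thesis
      by (simp add: word_sum_words_odd[OF F' perms(3,7,1,2)])
         (simp add: word_sum_words_odd[OF F perms(7,3,2,1)] comp_assoc relations invariant_H\<^sub>2[OF F])
  qed
  ultimately show ?thesis
    unfolding isogenous_def using intertwines_words_odd by fast
qed

section \<open>The subgroups are not isomorphic\<close>

text \<open>Some \<open>x\<close> commuting with an element \<open>t\<close> of order 3 has a square that is a commutator of \<open>u\<close> and \<open>v\<close>,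
  and \<open>x ^ 6\<close> is not 1.\<close>

definition has_commutator_square :: "('g, 'b) monoid_scheme \<Rightarrow> bool" where
  "has_commutator_square K \<longleftrightarrow> (\<exists>x\<in>carrier K. \<exists>t\<in>carrier K. \<exists>u\<in>carrier K. \<exists>v\<in>carrier K.
    t \<otimes>\<^bsub>K\<^esub> (t \<otimes>\<^bsub>K\<^esub> t) = \<one>\<^bsub>K\<^esub> \<and> t \<noteq> \<one>\<^bsub>K\<^esub> \<and> x \<otimes>\<^bsub>K\<^esub> t = t \<otimes>\<^bsub>K\<^esub> x
    \<and> (x \<otimes>\<^bsub>K\<^esub> x) \<otimes>\<^bsub>K\<^esub> (v \<otimes>\<^bsub>K\<^esub> u) = u \<otimes>\<^bsub>K\<^esub> v
    \<and> (x \<otimes>\<^bsub>K\<^esub> x) \<otimes>\<^bsub>K\<^esub> ((x \<otimes>\<^bsub>K\<^esub> x) \<otimes>\<^bsub>K\<^esub> (x \<otimes>\<^bsub>K\<^esub> x)) \<noteq> \<one>\<^bsub>K\<^esub>)"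

lemma has_commutator_squareE:
  assumes "has_commutator_square K"
  obtains x t u v where "x \<in> carrier K" "t \<in> carrier K" "u \<in> carrier K" "v \<in> carrier K"
    "t \<otimes>\<^bsub>K\<^esub> (t \<otimes>\<^bsub>K\<^esub> t) = \<one>\<^bsub>K\<^esub>" "t \<noteq> \<one>\<^bsub>K\<^esub>" "x \<otimes>\<^bsub>K\<^esub> t = t \<otimes>\<^bsub>K\<^esub> x"
    "(x \<otimes>\<^bsub>K\<^esub> x) \<otimes>\<^bsub>K\<^esub> (v \<otimes>\<^bsub>K\<^esub> u) = u \<otimes>\<^bsub>K\<^esub> v"
    "(x \<otimes>\<^bsub>K\<^esub> x) \<otimes>\<^bsub>K\<^esub> ((x \<otimes>\<^bsub>K\<^esub> x) \<otimes>\<^bsub>K\<^esub> (x \<otimes>\<^bsub>K\<^esub> x)) \<noteq> \<one>\<^bsub>K\<^esub>"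
  using assms unfolding has_commutator_square_def by blast

lemma has_commutator_square_iso:
  assumes "group K" "group L" "K \<cong> L" "has_commutator_square K"
  shows "has_commutator_square L"
proof -
  interpret K: group K by fact
  from assms(3) obtain h where h: "h \<in> iso K L" by (auto simp: is_iso_def)
  then interpret group_hom K L h
    using assms(1,2) by (intro group_hom.intro group_hom_axioms.intro) (auto simp: iso_def)
  have inj: "inj_on h (carrier K)" using h by (simp add: iso_def bij_betw_def)
  have eq: "h a = h b \<longleftrightarrow> a = b" if "a \<in> carrier K" "b \<in> carrier K" for a b
    using inj that by (rule inj_on_eq_iff)
  from assms(4) obtain x t u v where "x \<in> carrier K" "t \<in> carrier K" "u \<in> carrier K" "v \<in> carrier K"
    "t \<otimes>\<^bsub>K\<^esub> (t \<otimes>\<^bsub>K\<^esub> t) = \<one>\<^bsub>K\<^esub>" "t \<noteq> \<one>\<^bsub>K\<^esub>" "x \<otimes>\<^bsub>K\<^esub> t = t \<otimes>\<^bsub>K\<^esub> x"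
    "(x \<otimes>\<^bsub>K\<^esub> x) \<otimes>\<^bsub>K\<^esub> (v \<otimes>\<^bsub>K\<^esub> u) = u \<otimes>\<^bsub>K\<^esub> v"
    "(x \<otimes>\<^bsub>K\<^esub> x) \<otimes>\<^bsub>K\<^esub> ((x \<otimes>\<^bsub>K\<^esub> x) \<otimes>\<^bsub>K\<^esub> (x \<otimes>\<^bsub>K\<^esub> x)) \<noteq> \<one>\<^bsub>K\<^esub>"
    by (rule has_commutator_squareE)
  then show ?thesis
    unfolding has_commutator_square_def
    by (intro bexI[of _ "h x"] bexI[of _ "h t"] bexI[of _ "h u"] bexI[of _ "h v"])
      (simp_all add: eq flip: hom_mult hom_one)
qed

lemma has_commutator_square_H\<^sub>1: "has_commutator_square (\<Gamma>\<lparr>carrier := H\<^sub>1\<rparr>)"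
proof -
  have "(\<rho>, id) \<in> H\<^sub>1" "(\<zeta>, \<alpha>) \<in> H\<^sub>1" "(\<sigma>, \<beta>) \<in> H\<^sub>1"
    unfolding H\<^sub>1_def by (auto intro: generate.incl)
  moreover have "\<rho> \<noteq> id" "\<gamma>\<^sub>2 \<noteq> id"
    by (auto simp: \<rho>_def \<gamma>\<^sub>2_def fun_eq_iff)
  ultimately show ?thesis
    unfolding has_commutator_square_def
    \<comment> \<open>The element \<open>(\<zeta>, \<alpha>)\<close> is \<open>x\<close> and also
      takes part in the commutator with \<open>(\<sigma>, \<beta>)\<close>. Its square is
      \<open>(id, \<gamma>\<^sub>2)\<close>, and so is its sixth power.\<close>
    by (intro bexI[of _ "(\<zeta>, \<alpha>)"] bexI[of _ "(\<rho>, id)"] bexI[of _ "(\<sigma>, \<beta>)"])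
      (simp_all add: comp_assoc relations relations_id)
qed

text \<open>The group called \<open>Z\<close> above, and below it the normal forms of the elements of \<open>H\<^sub>2\<close>.\<close>

definition \<Delta> :: "(nat \<Rightarrow> nat) set" where
  "\<Delta> = {id, \<gamma>\<^sub>1, \<gamma>\<^sub>2, \<gamma>\<^sub>3, \<gamma>\<^sub>1 \<circ> \<gamma>\<^sub>2, \<gamma>\<^sub>1 \<circ> \<gamma>\<^sub>3, \<gamma>\<^sub>2 \<circ> \<gamma>\<^sub>3, \<gamma>\<^sub>1 \<circ> (\<gamma>\<^sub>2 \<circ> \<gamma>\<^sub>3)}"

lemma \<Delta>_closed:
  assumes "c \<in> \<Delta>"
  shows "\<gamma>\<^sub>1 \<circ> c \<in> \<Delta>" "\<gamma>\<^sub>2 \<circ> c \<in> \<Delta>" "\<gamma>\<^sub>3 \<circ> c \<in> \<Delta>"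
    "c \<circ> \<gamma>\<^sub>2 \<in> \<Delta>" "c \<circ> \<gamma>\<^sub>3 \<in> \<Delta>" "c \<circ> (\<gamma>\<^sub>2 \<circ> \<gamma>\<^sub>3) \<in> \<Delta>"
  using assms by (auto simp: \<Delta>_def comp_assoc relations relations_id)

lemma \<Delta>_central:
  assumes "c \<in> \<Delta>"
  shows "\<alpha> \<circ> (c \<circ> y) = c \<circ> (\<alpha> \<circ> y)" "\<beta> \<circ> (c \<circ> y) = c \<circ> (\<beta> \<circ> y)" "c \<circ> (c \<circ> y) = y"
    "\<gamma>\<^sub>2 \<circ> (c \<circ> y) = c \<circ> (\<gamma>\<^sub>2 \<circ> y)" "\<gamma>\<^sub>3 \<circ> (c \<circ> y) = c \<circ> (\<gamma>\<^sub>3 \<circ> y)"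
  using assms by (auto simp: \<Delta>_def comp_assoc relations)

definition N\<^sub>2 :: "((nat \<Rightarrow> nat) \<times> (nat \<Rightarrow> nat)) set" where
  "N\<^sub>2 = {(r \<circ> (s \<circ> z), c \<circ> (a \<circ> b)) | r s z a b c. r \<in> {id, \<rho>, \<rho> \<circ> \<rho>}
    \<and> (s, a) \<in> {(id, id), (\<sigma>, \<alpha>)} \<and> (z, b) \<in> {(id, id), (\<zeta>, \<beta>)} \<and> c \<in> \<Delta>}"

lemma N\<^sub>2I:
  assumes "r \<in> {id, \<rho>, \<rho> \<circ> \<rho>}" "(s, a) \<in> {(id, id), (\<sigma>, \<alpha>)}" "(z, b) \<in> {(id, id), (\<zeta>, \<beta>)}" "c \<in> \<Delta>"
    "g = r \<circ> (s \<circ> z)" "y = c \<circ> (a \<circ> b)"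
  shows "(g, y) \<in> N\<^sub>2"
  using assms unfolding N\<^sub>2_def by blast

lemma N\<^sub>2E:
  assumes "(g, y) \<in> N\<^sub>2"
  obtains r s z a b c where "r \<in> {id, \<rho>, \<rho> \<circ> \<rho>}" "(s, a) \<in> {(id, id), (\<sigma>, \<alpha>)}"
    "(z, b) \<in> {(id, id), (\<zeta>, \<beta>)}" "c \<in> \<Delta>" "g = r \<circ> (s \<circ> z)" "y = c \<circ> (a \<circ> b)"
  using assms unfolding N\<^sub>2_def by blast

lemma N\<^sub>2_closed:
  assumes "(g, y) \<in> N\<^sub>2"
  shows "(\<rho> \<circ> g, y) \<in> N\<^sub>2" "(\<sigma> \<circ> g, \<alpha> \<circ> y) \<in> N\<^sub>2" "(\<zeta> \<circ> g, \<beta> \<circ> y) \<in> N\<^sub>2"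
    "(g, \<gamma>\<^sub>1 \<circ> y) \<in> N\<^sub>2" "(g, \<gamma>\<^sub>2 \<circ> y) \<in> N\<^sub>2" "(g, \<gamma>\<^sub>3 \<circ> y) \<in> N\<^sub>2"
proof -
  from assms obtain r s z a b c where h: "r \<in> {id, \<rho>, \<rho> \<circ> \<rho>}" "(s, a) \<in> {(id, id), (\<sigma>, \<alpha>)}"
    "(z, b) \<in> {(id, id), (\<zeta>, \<beta>)}" "c \<in> \<Delta>" and gy: "g = r \<circ> (s \<circ> z)" "y = c \<circ> (a \<circ> b)"
    by (rule N\<^sub>2E)
  note c = \<Delta>_closed[OF h(4)] \<Delta>_central[OF h(4)] \<Delta>_central[OF h(4), of id, unfolded comp_id]
  show "(\<rho> \<circ> g, y) \<in> N\<^sub>2"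
    using h(1) by (intro N\<^sub>2I[OF _ h(2-4), of "if r = \<rho> \<circ> \<rho> then id else \<rho> \<circ> r"])
      (auto simp: gy comp_assoc relations relations_id)
  show "(g, \<gamma>\<^sub>1 \<circ> y) \<in> N\<^sub>2" "(g, \<gamma>\<^sub>2 \<circ> y) \<in> N\<^sub>2" "(g, \<gamma>\<^sub>3 \<circ> y) \<in> N\<^sub>2"
    by (rule N\<^sub>2I[OF h(1-3) c(1) gy(1)] N\<^sub>2I[OF h(1-3) c(2) gy(1)] N\<^sub>2I[OF h(1-3) c(3) gy(1)];
      simp add: gy comp_assoc)+
  \<comment> \<open>This is the inverse of \<open>r\<close>, since \<open>\<sigma>\<close> inverts
    \<open>\<rho>\<close>.\<close>
  have r': "(if r = id then id else if r = \<rho> then \<rho> \<circ> \<rho> else \<rho>) \<in> {id, \<rho>, \<rho> \<circ> \<rho>}" (is "?r \<in> _") by auto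
  have "\<rho> \<noteq> id" "\<rho> \<circ> \<rho> \<noteq> id" "\<rho> \<circ> \<rho> \<noteq> \<rho>" by (auto simp: \<rho>_def fun_eq_iff)
  then have sr: "\<sigma> \<circ> (r \<circ> x) = ?r \<circ> (\<sigma> \<circ> x)" for x using h(1) by (auto simp: comp_assoc relations)
  have zr: "\<zeta> \<circ> (r \<circ> x) = r \<circ> (\<zeta> \<circ> x)" for x using h(1) by (auto simp: comp_assoc relations)
  from h(2) consider "s = id" "a = id" | "s = \<sigma>" "a = \<alpha>" by auto
  then show "(\<sigma> \<circ> g, \<alpha> \<circ> y) \<in> N\<^sub>2"
  proof cases
    case 1
    then show ?thesis
      by (intro N\<^sub>2I[OF r' _ h(3,4), of \<sigma> \<alpha>]) (simp_all add: gy sr c)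
  next
    case 2
    then show ?thesis
      by (intro N\<^sub>2I[OF r' _ h(3) c(2), of id id]) (simp_all add: gy sr c comp_assoc relations)
  qed
  from h(3) consider "z = id" "b = id" | "z = \<zeta>" "b = \<beta>" by auto
  then show "(\<zeta> \<circ> g, \<beta> \<circ> y) \<in> N\<^sub>2"
  proof cases
    case 1
    \<comment> \<open>Moving \<open>\<beta>\<close> past \<open>\<alpha>\<close> costs a factor
      \<open>\<gamma>\<^sub>2\<close>; in the second case the square of \<open>\<beta>\<close> adds
      \<open>\<gamma>\<^sub>3\<close>.\<close>
    with h(2) show ?thesis
      by (intro N\<^sub>2I[OF h(1,2) _, of \<zeta> \<beta> "if a = id then c else c \<circ> \<gamma>\<^sub>2"])
        (auto simp: gy zr h(4) c comp_assoc relations relations_id)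
  next
    case 2
    with h(2) show ?thesis
      by (intro N\<^sub>2I[OF h(1,2) _, of id id "if a = id then c \<circ> \<gamma>\<^sub>3 else c \<circ> (\<gamma>\<^sub>2 \<circ> \<gamma>\<^sub>3)"])
        (auto simp: gy zr h(4) c comp_assoc relations relations_id)
  qed
qed

text \<open>The converse directions hold because repeating a generator leads back:
  \<open>\<rho>\<close> has order 3, and the other generators square to the identity or to a central
  involution already treated.\<close>

lemma N\<^sub>2_cancel:
  "(\<rho> \<circ> g, y) \<in> N\<^sub>2 \<longleftrightarrow> (g, y) \<in> N\<^sub>2" "(\<sigma> \<circ> g, \<alpha> \<circ> y) \<in> N\<^sub>2 \<longleftrightarrow> (g, y) \<in> N\<^sub>2"
  "(\<zeta> \<circ> g, \<beta> \<circ> y) \<in> N\<^sub>2 \<longleftrightarrow> (g, y) \<in> N\<^sub>2" "(g, \<gamma>\<^sub>1 \<circ> y) \<in> N\<^sub>2 \<longleftrightarrow> (g, y) \<in> N\<^sub>2"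
  "(g, \<gamma>\<^sub>2 \<circ> y) \<in> N\<^sub>2 \<longleftrightarrow> (g, y) \<in> N\<^sub>2" "(g, \<gamma>\<^sub>3 \<circ> y) \<in> N\<^sub>2 \<longleftrightarrow> (g, y) \<in> N\<^sub>2"
proof -
  have \<gamma>: "(g, \<gamma>\<^sub>1 \<circ> y) \<in> N\<^sub>2 \<longleftrightarrow> (g, y) \<in> N\<^sub>2" "(g, \<gamma>\<^sub>2 \<circ> y) \<in> N\<^sub>2 \<longleftrightarrow> (g, y) \<in> N\<^sub>2"
    "(g, \<gamma>\<^sub>3 \<circ> y) \<in> N\<^sub>2 \<longleftrightarrow> (g, y) \<in> N\<^sub>2" for g y
    using N\<^sub>2_closed(4-6)[of g y] N\<^sub>2_closed(4)[of g "\<gamma>\<^sub>1 \<circ> y"] N\<^sub>2_closed(5)[of g "\<gamma>\<^sub>2 \<circ> y"]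
      N\<^sub>2_closed(6)[of g "\<gamma>\<^sub>3 \<circ> y"] unfolding relations by blast+
  show "(g, \<gamma>\<^sub>1 \<circ> y) \<in> N\<^sub>2 \<longleftrightarrow> (g, y) \<in> N\<^sub>2" "(g, \<gamma>\<^sub>2 \<circ> y) \<in> N\<^sub>2 \<longleftrightarrow> (g, y) \<in> N\<^sub>2"
    "(g, \<gamma>\<^sub>3 \<circ> y) \<in> N\<^sub>2 \<longleftrightarrow> (g, y) \<in> N\<^sub>2" by (rule \<gamma>)+
  show "(\<rho> \<circ> g, y) \<in> N\<^sub>2 \<longleftrightarrow> (g, y) \<in> N\<^sub>2"
    using N\<^sub>2_closed(1)[of g y] N\<^sub>2_closed(1)[of "\<rho> \<circ> g" y] N\<^sub>2_closed(1)[of "\<rho> \<circ> (\<rho> \<circ> g)" y]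
    unfolding relations by blast
  show "(\<sigma> \<circ> g, \<alpha> \<circ> y) \<in> N\<^sub>2 \<longleftrightarrow> (g, y) \<in> N\<^sub>2"
    using N\<^sub>2_closed(2)[of g y] N\<^sub>2_closed(2)[of "\<sigma> \<circ> g" "\<alpha> \<circ> y"] unfolding relations \<gamma> by blast
  show "(\<zeta> \<circ> g, \<beta> \<circ> y) \<in> N\<^sub>2 \<longleftrightarrow> (g, y) \<in> N\<^sub>2"
    using N\<^sub>2_closed(3)[of g y] N\<^sub>2_closed(3)[of "\<zeta> \<circ> g" "\<beta> \<circ> y"] unfolding relations \<gamma> by blast
qed

lemma H\<^sub>2_subset: "H\<^sub>2 \<subseteq> N\<^sub>2"
proof
  fix h assume h: "h \<in> H\<^sub>2"
  \<comment> \<open>Invariance of an indicator function spares us the closure of \<open>N\<^sub>2\<close> under products.\<close>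
  define F where "F x = (if x \<in> carrier \<Gamma> \<and> x \<in> N\<^sub>2 then 1 else 0 :: int)" for x
  have "left_invariant \<Gamma> H\<^sub>2 F"
    using gens_closed
    by (intro left_invariant_H(2))
      (auto simp: F_def N\<^sub>2_cancel comp_in_carrier_iff comp_in_carrier_iff[of _ id, simplified]
        comp_in_carrier_iff[of id, simplified])
  moreover have "(id, id) \<in> N\<^sub>2"
    by (rule N\<^sub>2I[of id id id id id id]) (auto simp: \<Delta>_def)
  moreover have "h \<in> carrier \<Gamma>" using h subgroup.subset[OF subgroup_H(2)] by blast
  ultimately have "F (h \<otimes>\<^bsub>\<Gamma>\<^esub> \<one>\<^bsub>\<Gamma>\<^esub>) = F \<one>\<^bsub>\<Gamma>\<^esub>" "F \<one>\<^bsub>\<Gamma>\<^esub> = 1" "h \<otimes>\<^bsub>\<Gamma>\<^esub> \<one>\<^bsub>\<Gamma>\<^esub> = h"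
    using left_invariant_eq[of \<Gamma> H\<^sub>2 F h "\<one>\<^bsub>\<Gamma>\<^esub>"] h \<Gamma>.one_closed \<Gamma>.r_one
    by (simp_all add: F_def del: one_\<Gamma>, simp)
  then show "h \<in> N\<^sub>2" by (simp add: F_def split: if_splits)
qed

text \<open>The factors other than \<open>r\<close> contribute only 2-power order, so they must
  disappear.\<close>

lemma N\<^sub>2_order_3:
  assumes "(g, y) \<in> N\<^sub>2" "g \<circ> (g \<circ> g) = id" "y \<circ> (y \<circ> y) = id" "(g, y) \<noteq> (id, id)"
  shows "g = \<rho> \<or> g = \<rho> \<circ> \<rho>"
proof -
  from assms(1) obtain r s z a b c where h: "r \<in> {id, \<rho>, \<rho> \<circ> \<rho>}" "(s, a) \<in> {(id, id), (\<sigma>, \<alpha>)}"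
    "(z, b) \<in> {(id, id), (\<zeta>, \<beta>)}" "c \<in> \<Delta>" and gy: "g = r \<circ> (s \<circ> z)" "y = c \<circ> (a \<circ> b)"
    by (rule N\<^sub>2E)
  \<comment> \<open>On the points 4 and 5 only \<open>z\<close> acts, and the cube of a
    transposition is not trivial.\<close>
  have z: "z = id"
    using fun_cong[OF assms(2), of 4] h(1-3) by (auto simp: gy perm_defs)
  \<comment> \<open>With \<open>s = \<sigma>\<close>, the map \<open>g\<close> would be a
    transposition on the points 1, 2, 3.\<close>
  have s: "s = id"
    using fun_cong[OF assms(2), of 1] fun_cong[OF assms(2), of 2] fun_cong[OF assms(2), of 3] h(1,2)
    by (auto simp: gy z perm_defs)
  have "y = c" using gy z s h(2,3) by (auto simp: \<sigma>_def \<zeta>_def fun_eq_iff split: if_splits)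
  with assms(3) have "c = id" using \<Delta>_central(3)[OF h(4), of c] \<Delta>_central(3)[OF h(4), of id] by simp
  with \<open>y = c\<close> assms(4) h(1) show ?thesis by (auto simp: gy z s)
qed

text \<open>\<open>H\<^sub>2\<close> acts on the last block of four points through a cyclic group of rotations, which detects
  \<open>\<beta>\<^sup>2\<close> and kills commutators.\<close>

definition rotates_block :: "nat \<Rightarrow> (nat \<Rightarrow> nat) \<Rightarrow> bool" where
  "rotates_block m y \<longleftrightarrow> (\<forall>k\<in>{0, 1, 2, 3}. y (9 + k) = 9 + (m + k) mod 4)"

lemma rotates_block_comp:
  assumes "rotates_block m y" "rotates_block n z"
  shows "rotates_block (m + n) (y \<circ> z)"
proof -
  have "y (z (9 + k)) = 9 + (m + n + k) mod 4" if "k \<in> {0, 1, 2, 3}" for k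
  proof -
    have "(n + k) mod 4 \<in> {0, 1, 2, 3}" using mod_less_divisor[of 4 "n + k"] by auto
    then have "y (9 + (n + k) mod 4) = 9 + (m + (n + k) mod 4) mod 4"
      using assms(1) by (simp only: rotates_block_def)
    with assms(2) that show ?thesis by (simp only: rotates_block_def mod_add_right_eq add.assoc)
  qed
  then show ?thesis unfolding rotates_block_def comp_apply by blast
qed

lemma N\<^sub>2_rotates_block:
  assumes "(g, y) \<in> N\<^sub>2"
  obtains m where "rotates_block m y"
proof -
  from assms obtain r s z a b c where h: "r \<in> {id, \<rho>, \<rho> \<circ> \<rho>}" "(s, a) \<in> {(id, id), (\<sigma>, \<alpha>)}"
    "(z, b) \<in> {(id, id), (\<zeta>, \<beta>)}" "c \<in> \<Delta>" and gy: "g = r \<circ> (s \<circ> z)" "y = c \<circ> (a \<circ> b)"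
    by (rule N\<^sub>2E)
  have base: "rotates_block 0 id" "rotates_block 0 \<gamma>\<^sub>1" "rotates_block 0 \<gamma>\<^sub>2" "rotates_block 2 \<gamma>\<^sub>3"
    "rotates_block 0 \<alpha>" "rotates_block 1 \<beta>"
    by (simp_all add: rotates_block_def perm_defs)
  have "\<exists>l. rotates_block l c" using h(4) unfolding \<Delta>_def by (blast intro: base rotates_block_comp)
  moreover have "\<exists>m. rotates_block m a" "\<exists>n. rotates_block n b" using h(2,3) base by blast+
  ultimately show thesis using that rotates_block_comp unfolding gy by blast
qed

lemma N\<^sub>2_commute_9:
  assumes "(g, y) \<in> N\<^sub>2" "(g', y') \<in> N\<^sub>2"
  shows "y (y' 9) = y' (y 9)" "y (y' 9) \<in> {9, 10, 11, 12}"
proof -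
  obtain m n where "rotates_block m y" "rotates_block n y'"
    using assms N\<^sub>2_rotates_block by metis
  then have mn: "rotates_block (m + n) (y \<circ> y')" "rotates_block (n + m) (y' \<circ> y)"
    by (simp_all only: rotates_block_comp)
  then have *: "y (y' 9) = 9 + (m + n) mod 4" "y' (y 9) = 9 + (n + m) mod 4"
    by (simp_all add: rotates_block_def)
  then show "y (y' 9) = y' (y 9)" by (simp add: add.commute)
  show "y (y' 9) \<in> {9, 10, 11, 12}" using *(1) mod_less_divisor[of 4 "m + n"] by auto
qed

text \<open>Commuting with an element of order 3 excludes \<open>\<alpha>\<close> from
  \<open>x\<^sub>0\<close>, being a commutator excludes \<open>\<beta>\<close> from its square, and
  what remains has exponent 6.\<close>

lemma not_has_commutator_square_H\<^sub>2: "\<not> has_commutator_square (\<Gamma>\<lparr>carrier := H\<^sub>2\<rparr>)"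
proof
  assume "has_commutator_square (\<Gamma>\<lparr>carrier := H\<^sub>2\<rparr>)"
  then obtain x\<^sub>0 t\<^sub>0 u\<^sub>0 v\<^sub>0 where H: "x\<^sub>0 \<in> H\<^sub>2" "t\<^sub>0 \<in> H\<^sub>2" "u\<^sub>0 \<in> H\<^sub>2" "v\<^sub>0 \<in> H\<^sub>2"
    and eq: "t\<^sub>0 \<otimes>\<^bsub>\<Gamma>\<^esub> (t\<^sub>0 \<otimes>\<^bsub>\<Gamma>\<^esub> t\<^sub>0) = \<one>\<^bsub>\<Gamma>\<^esub>" "t\<^sub>0 \<noteq> \<one>\<^bsub>\<Gamma>\<^esub>" "x\<^sub>0 \<otimes>\<^bsub>\<Gamma>\<^esub> t\<^sub>0 = t\<^sub>0 \<otimes>\<^bsub>\<Gamma>\<^esub> x\<^sub>0"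
      "(x\<^sub>0 \<otimes>\<^bsub>\<Gamma>\<^esub> x\<^sub>0) \<otimes>\<^bsub>\<Gamma>\<^esub> (v\<^sub>0 \<otimes>\<^bsub>\<Gamma>\<^esub> u\<^sub>0) = u\<^sub>0 \<otimes>\<^bsub>\<Gamma>\<^esub> v\<^sub>0"
      "(x\<^sub>0 \<otimes>\<^bsub>\<Gamma>\<^esub> x\<^sub>0) \<otimes>\<^bsub>\<Gamma>\<^esub> ((x\<^sub>0 \<otimes>\<^bsub>\<Gamma>\<^esub> x\<^sub>0) \<otimes>\<^bsub>\<Gamma>\<^esub> (x\<^sub>0 \<otimes>\<^bsub>\<Gamma>\<^esub> x\<^sub>0)) \<noteq> \<one>\<^bsub>\<Gamma>\<^esub>"
    by (rule has_commutator_squareE) (simp del: one_\<Gamma>)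
  obtain g y t y\<^sub>t u y\<^sub>u v y\<^sub>v where xtuv: "x\<^sub>0 = (g, y)" "t\<^sub>0 = (t, y\<^sub>t)" "u\<^sub>0 = (u, y\<^sub>u)" "v\<^sub>0 = (v, y\<^sub>v)"
    by (metis surj_pair)
  have N: "(g, y) \<in> N\<^sub>2" "(t, y\<^sub>t) \<in> N\<^sub>2" "(u, y\<^sub>u) \<in> N\<^sub>2" "(v, y\<^sub>v) \<in> N\<^sub>2"
    using H H\<^sub>2_subset unfolding xtuv by blast+
  have t: "t \<circ> (t \<circ> t) = id" "y\<^sub>t \<circ> (y\<^sub>t \<circ> y\<^sub>t) = id" "(t, y\<^sub>t) \<noteq> (id, id)" and gt: "g \<circ> t = t \<circ> g"
    and comm: "(y \<circ> y) \<circ> (y\<^sub>v \<circ> y\<^sub>u) = y\<^sub>u \<circ> y\<^sub>v"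
    and six: "((g \<circ> g) \<circ> ((g \<circ> g) \<circ> (g \<circ> g)), (y \<circ> y) \<circ> ((y \<circ> y) \<circ> (y \<circ> y))) \<noteq> (id, id)"
    using eq unfolding xtuv by simp_all
  from N(1) obtain r s z a b c where h: "r \<in> {id, \<rho>, \<rho> \<circ> \<rho>}" "(s, a) \<in> {(id, id), (\<sigma>, \<alpha>)}"
    "(z, b) \<in> {(id, id), (\<zeta>, \<beta>)}" "c \<in> \<Delta>" and gy: "g = r \<circ> (s \<circ> z)" "y = c \<circ> (a \<circ> b)"
    by (rule N\<^sub>2E)
  \<comment> \<open>Here \<open>t\<close> is \<open>\<rho>\<close> or its inverse, neither of which
    commutes with a map that acts on 1, 2, 3 as a transposition.\<close>
  have "s \<noteq> \<sigma>"
    using N\<^sub>2_order_3[OF N(2) t] h(1,3) fun_cong[OF gt, of 1] fun_cong[OF gt, of 2] fun_cong[OF gt, of 3]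
    by (auto simp: gy perm_defs)
  with h(2) have sa: "s = id" "a = id" by auto
  have yy: "y \<circ> y = b \<circ> b" using h(3) by (auto simp: gy sa comp_assoc \<Delta>_central[OF h(4)]
      \<Delta>_central[OF h(4), of id, unfolded comp_id])
  \<comment> \<open>Rotations of the last block commute, so a commutator fixes its points; the
    square of \<open>\<beta>\<close> fixes none of them.\<close>
  have "(b \<circ> b) (y\<^sub>u (y\<^sub>v 9)) = y\<^sub>u (y\<^sub>v 9)"
    using fun_cong[OF comm, of 9] N\<^sub>2_commute_9(1)[OF N(3,4)] by (simp add: yy)
  moreover have "y\<^sub>u (y\<^sub>v 9) \<in> {9, 10, 11, 12}" by (rule N\<^sub>2_commute_9(2)[OF N(3,4)])
  ultimately have "b \<noteq> \<beta>" by (auto simp: \<beta>_def)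
  with h(3) have "z = id" "b = id" by auto
  with six yy h(1) show False by (auto simp: gy sa comp_assoc relations relations_id)
qed

section \<open>Choice of the degree for each prime, and transport to the natural numbers\<close>

lemma prime_coprime_9_or_16:
  assumes "prime (p :: nat)"
  shows "coprime 9 (int p) \<or> coprime 16 (int p)"
proof (cases "p = 3")
  case False
  then have "coprime 3 p"
    using assms primes_coprime[of 3 p] by simp
  then have "coprime (int 3) (int p)" by (simp only: coprime_int_iff)
  then have "coprime (int 3 ^ 2) (int p)" by (simp only: coprime_power_left_iff) simp
  then show ?thesis by simp
next
  case True
  then have "coprime 2 p"
    using assms primes_coprime[of 2 p] by simp
  then have "coprime (int 2) (int p)" by (simp only: coprime_int_iff)
  then have "coprime (int 2 ^ 4) (int p)" by (simp only: coprime_power_left_iff) simp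
  then show ?thesis by simp
qed

theorem mainTheorem2:
  shows "\<exists>(G :: nat monoid) H\<^sub>1 H\<^sub>2.
    group G \<and> finite (carrier G) \<and> subgroup H\<^sub>1 G \<and> subgroup H\<^sub>2 G
    \<and> locally_integrally_equivalent G H\<^sub>1 H\<^sub>2
    \<and> \<not> (G\<lparr>carrier := H\<^sub>1\<rparr> \<cong> G\<lparr>carrier := H\<^sub>2\<rparr>)"
proof -
  \<comment> \<open>The statement asks for a group of natural numbers, so the finite group
    \<open>\<Gamma>\<close> is copied along an injection.\<close>
  obtain e :: "(nat \<Rightarrow> nat) \<times> (nat \<Rightarrow> nat) \<Rightarrow> nat" where "inj_on e (carrier \<Gamma>)"
    using finite_imp_inj_to_nat_seg[OF finite_\<Gamma>] by blast
  define G where "G = image_group e \<Gamma>"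
  have e: "e \<in> iso \<Gamma> G"
    unfolding G_def by (rule inj_imp_image_group_iso) fact
  have G: "group G"
    unfolding G_def by (rule \<Gamma>.inj_imp_image_group_is_group) fact
  have fin: "finite (carrier G)"
    using finite_\<Gamma> by (simp add: G_def image_group_carrier)
  have sub: "subgroup (e ` H\<^sub>1) G" "subgroup (e ` H\<^sub>2) G"
    using subgroup.iso_subgroup[OF subgroup_H(1) group_\<Gamma> G e] subgroup.iso_subgroup[OF subgroup_H(2) group_\<Gamma> G e] .
  have "isogenous G (e ` H\<^sub>1) (e ` H\<^sub>2) 9" "isogenous G (e ` H\<^sub>1) (e ` H\<^sub>2) 16"
    by (intro isogenous_iso_image[OF group_\<Gamma> G e] subgroup.subset[OF subgroup_H(1)]
      subgroup.subset[OF subgroup_H(2)] isogenous_9 isogenous_16)+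
  then have "locally_integrally_equivalent G (e ` H\<^sub>1) (e ` H\<^sub>2)"
    unfolding locally_integrally_equivalent_def
    using isogenous_imp_gmodule_iso[OF G sub] prime_coprime_9_or_16 prime_gt_0_nat by metis
  moreover have "\<not> G\<lparr>carrier := e ` H\<^sub>1\<rparr> \<cong> G\<lparr>carrier := e ` H\<^sub>2\<rparr>"
  proof
    assume G_iso: "G\<lparr>carrier := e ` H\<^sub>1\<rparr> \<cong> G\<lparr>carrier := e ` H\<^sub>2\<rparr>"
    have groups: "group (\<Gamma>\<lparr>carrier := H\<^sub>1\<rparr>)" "group (\<Gamma>\<lparr>carrier := H\<^sub>2\<rparr>)"
      using subgroup_H group_\<Gamma> by (simp_all add: subgroup.subgroup_is_group)
    have "\<Gamma>\<lparr>carrier := H\<^sub>1\<rparr> \<cong> G\<lparr>carrier := e ` H\<^sub>1\<rparr>" "\<Gamma>\<lparr>carrier := H\<^sub>2\<rparr> \<cong> G\<lparr>carrier := e ` H\<^sub>2\<rparr>"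
      using iso_restrict[OF e group_\<Gamma> G] subgroup_H by (blast intro: is_isoI)+
    then have "\<Gamma>\<lparr>carrier := H\<^sub>1\<rparr> \<cong> \<Gamma>\<lparr>carrier := H\<^sub>2\<rparr>"
      by (rule iso_trans[OF iso_trans[OF _ G_iso] group.iso_sym[OF groups(2)]])
    then show False
      using has_commutator_square_iso[OF groups] has_commutator_square_H\<^sub>1
        not_has_commutator_square_H\<^sub>2 by blast
  qed
  ultimately show ?thesis using G fin sub by blast
qed

end
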